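(* Suppose $\{\delta_a:a\in A\}\subseteq Q$ and the adversary is weakly communicating. Then for every $\mu\in\mathrm{Prob}(S)$, $$\underline\alpha(\mu,\Pi_H,K_S)=\inf_{\kappa\in K_S}\sup_{\pi\in\Pi_H}\underline\alpha(\mu,\pi,\kappa)=\inf_{\kappa\in K_S}\sup_{\pi\in\Pi_S}\underline\alpha(\mu,\pi,\kappa),$$ and the same holds with $\underline\alpha$ replaced by $\overline\alpha$ throughout. Moreover, if the inf-sup equation $$u'(s)=\inf_{p_s\in\mathcal{P}_s}\sup_{\phi\in Q}\sum_{a\in A}\sum_{s'\in S}\phi(a)p_s(s'|a)\big[r(s,a)-\alpha'+u'(s')\big]\qquad\forall s\in S$$ admits a solution pair $(u',\alpha')$ with $u':S\to\mathbb{R}$ and $\alpha'\in[0,1]$, then $$\underline\alpha(\mu,\Pi_H,K_S)=\overline\alpha(\mu,\Pi_H,K_S)=\alpha'.$$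
   Context: $S$ (states) and $A$ (actions) are finite nonempty sets; $\mathrm{Prob}(E)$ is the set of probability distributions on a finite set $E$; $\delta_a$ is the Dirac measure at $a$; $r:S\times A\to[0,1]$ is a reward function. $Q\subseteq\mathrm{Prob}(A)$ is the set of the controller's admissible randomized actions. For each $s\in S$, $\mathcal{P}_s$ is a nonempty set of maps $p_s:A\to\mathrm{Prob}(S)$, written $p_s(s'|a)$; $\mathcal{P}=\prod_{s\in S}\mathcal{P}_s$, and $p\in\mathcal{P}$ is written $p(s'|s,a)=p_s(s'|a)$. Histories: $h_t=(s_0,a_0,\dots,s_{t-1},a_{t-1},s_t)\in(S\times A)^t\times S$. $\Pi_H$ is the set of history-dependent controller policies $\pi=(\pi_0,\pi_1,\dots)$ with $\pi_t(\cdot|h_t)\in Q$ for all $t,h_t$. $\Pi_S\subseteq\Pi_H$ is the set of stationary ones, $\pi_t(\cdot|h_t)=\Delta(\cdot|s_t)$ for a single map $\Delta:S\to Q$. $K_S$ is the set of stationary adversary policies $\kappa=(\kappa_0,\kappa_1,\dots)$, i.e. $\kappa_t(s'|h_t,a)=p(s'|s_t,a)$ for a single $p\in\mathcal{P}$ (identified with $p$). For $\mu\in\mathrm{Prob}(S)$, $\pi$, $\kappa$, $E_\mu^{\pi,\kappa}$ is expectation under the law of $(X_0,A_0,X_1,A_1,\dots)$ with $X_0\sim\mu$, $A_t\sim\pi_t(\cdot|H_t)$ given $H_t=(X_0,A_0,\dots,X_t)$, and $X_{t+1}\sim\kappa_t(\cdot|H_t,A_t)$ given $(H_t,A_t)$.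 Define $$\overline\alpha(\mu,\pi,\kappa)=\limsup_{n\to\infty}E_\mu^{\pi,\kappa}\frac1n\sum_{k=0}^{n-1}r(X_k,A_k),\quad \underline\alpha(\mu,\pi,\kappa)=\liminf_{n\to\infty}E_\mu^{\pi,\kappa}\frac1n\sum_{k=0}^{n-1}r(X_k,A_k),$$ $\overline\alpha(\mu,\Pi,K)=\sup_{\pi\in\Pi}\inf_{\kappa\in K}\overline\alpha(\mu,\pi,\kappa)$, $\underline\alpha(\mu,\Pi,K)=\sup_{\pi\in\Pi}\inf_{\kappa\in K}\underline\alpha(\mu,\pi,\kappa)$. For $p\in\mathcal{P}$ and $\Delta:S\to Q$, $p_\Delta(s'|s)=\sum_{a}p(s'|s,a)\Delta(a|s)$ and $p_\Delta^n$ is its $n$-th matrix power. $p\in\mathcal{P}$ is weakly communicating if there is a set $C_p\subseteq S$ such that for any $s,s'\in C_p$ there exist $\Delta:S\to Q$ and $N\ge1$ with $p_\Delta^N(s'|s)>0$, and every $s\in S\setminus C_p$ is transient for the Markov chain $p_\Delta$ for every $\Delta:S\to Q$. The adversary is weakly communicating if every $p\in\mathcal{P}$ is. *)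

theory Defs
  imports "HOL-Probability.Probability"
begin

text \<open>
  A history \<open>h\<^sub>t = (s\<^sub>0, a\<^sub>0, \<dots>, s\<^sub>t\<^sub>-\<^sub>1, a\<^sub>t\<^sub>-\<^sub>1, s\<^sub>t)\<close> is split into the list of the first \<open>t\<close>
  state-action pairs and the current state. Since the length of the list is \<open>t\<close>, a single
  function on all histories is the same thing as a sequence \<open>(\<pi>\<^sub>0, \<pi>\<^sub>1, \<dots>)\<close>.
\<close>

type_synonym ('s, 'a) policy = "('s \<times> 'a) list \<Rightarrow> 's \<Rightarrow> 'a pmf"
type_synonym ('s, 'a) adversary = "('s \<times> 'a) list \<Rightarrow> 's \<Rightarrow> 'a \<Rightarrow> 's pmf"

definition decision_rules :: "'a pmf set \<Rightarrow> ('s \<Rightarrow> 'a pmf) set" where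
  "decision_rules Q = {\<Delta>. \<forall>s. \<Delta> s \<in> Q}"

definition kernels :: "('s \<Rightarrow> ('a \<Rightarrow> 's pmf) set) \<Rightarrow> ('s \<Rightarrow> 'a \<Rightarrow> 's pmf) set" where
  "kernels P = {p. \<forall>s. p s \<in> P s}"

definition history_policies :: "'a pmf set \<Rightarrow> ('s, 'a) policy set" where
  "history_policies Q = {\<pi>. \<forall>h s. \<pi> h s \<in> Q}"

definition stationary_policies :: "'a pmf set \<Rightarrow> ('s, 'a) policy set" where
  "stationary_policies Q = {\<pi>. \<exists>\<Delta>\<in>decision_rules Q. \<pi> = (\<lambda>h s. \<Delta> s)}"

definition stationary_adversaries ::
    "('s \<Rightarrow> ('a \<Rightarrow> 's pmf) set) \<Rightarrow> ('s, 'a) adversary set" where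
  "stationary_adversaries P = {\<kappa>. \<exists>p\<in>kernels P. \<kappa> = (\<lambda>h s a. p s a)}"

text \<open>
  \<open>history_law \<mu> \<pi> \<kappa> n\<close> is the law of \<open>H\<^sub>n = (X\<^sub>0, A\<^sub>0, \<dots>, X\<^sub>n\<^sub>-\<^sub>1, A\<^sub>n\<^sub>-\<^sub>1, X\<^sub>n)\<close>. These laws are the
  finite-dimensional marginals of the law of the whole process (they are consistent, see
  \<open>history_law_consistent\<close>), and the \<open>n\<close>-step average reward is a function of \<open>H\<^sub>n\<close> only.
\<close>

primrec history_law ::
    "'s pmf \<Rightarrow> ('s, 'a) policy \<Rightarrow> ('s, 'a) adversary \<Rightarrow> nat \<Rightarrow> (('s \<times> 'a) list \<times> 's) pmf" where
  "history_law \<mu> \<pi> \<kappa> 0 = map_pmf (\<lambda>s. ([], s)) \<mu>"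
| "history_law \<mu> \<pi> \<kappa> (Suc n) =
     bind_pmf (history_law \<mu> \<pi> \<kappa> n) (\<lambda>(h, s).
       bind_pmf (\<pi> h s) (\<lambda>a.
         map_pmf (\<lambda>s'. (h @ [(s, a)], s')) (\<kappa> h s a)))"

lemma history_law_consistent:
  "map_pmf (\<lambda>(h, s). (butlast h, fst (last h))) (history_law \<mu> \<pi> \<kappa> (Suc n)) =
     history_law \<mu> \<pi> \<kappa> n"
  by (simp add: map_bind_pmf case_prod_unfold map_pmf_comp bind_return_pmf')

definition average_reward ::
    "('s \<Rightarrow> 'a \<Rightarrow> real) \<Rightarrow> 's pmf \<Rightarrow> ('s, 'a) policy \<Rightarrow> ('s, 'a) adversary \<Rightarrow> nat \<Rightarrow> real" where
  "average_reward r \<mu> \<pi> \<kappa> n =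
     measure_pmf.expectation (history_law \<mu> \<pi> \<kappa> n)
       (\<lambda>(h, s). (1 / real n) * (\<Sum>k<n. r (fst (h ! k)) (snd (h ! k))))"

definition upper_gain ::
    "('s \<Rightarrow> 'a \<Rightarrow> real) \<Rightarrow> 's pmf \<Rightarrow> ('s, 'a) policy \<Rightarrow> ('s, 'a) adversary \<Rightarrow> ereal" where
  "upper_gain r \<mu> \<pi> \<kappa> = limsup (\<lambda>n. ereal (average_reward r \<mu> \<pi> \<kappa> n))"

definition lower_gain ::
    "('s \<Rightarrow> 'a \<Rightarrow> real) \<Rightarrow> 's pmf \<Rightarrow> ('s, 'a) policy \<Rightarrow> ('s, 'a) adversary \<Rightarrow> ereal" where
  "lower_gain r \<mu> \<pi> \<kappa> = liminf (\<lambda>n. ereal (average_reward r \<mu> \<pi> \<kappa> n))"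

definition upper_value ::
    "('s \<Rightarrow> 'a \<Rightarrow> real) \<Rightarrow> 's pmf \<Rightarrow> ('s, 'a) policy set \<Rightarrow> ('s, 'a) adversary set \<Rightarrow> ereal" where
  "upper_value r \<mu> Pol K = (SUP \<pi>\<in>Pol. INF \<kappa>\<in>K. upper_gain r \<mu> \<pi> \<kappa>)"

definition lower_value ::
    "('s \<Rightarrow> 'a \<Rightarrow> real) \<Rightarrow> 's pmf \<Rightarrow> ('s, 'a) policy set \<Rightarrow> ('s, 'a) adversary set \<Rightarrow> ereal" where
  "lower_value r \<mu> Pol K = (SUP \<pi>\<in>Pol. INF \<kappa>\<in>K. lower_gain r \<mu> \<pi> \<kappa>)"

text \<open>Row index: current state; column index: next state.\<close>

definition transition_matrix ::
    "('s \<Rightarrow> 'a \<Rightarrow> 's pmf) \<Rightarrow> ('s \<Rightarrow> 'a pmf) \<Rightarrow> real ^ 's ^ ('s::finite)" where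
  "transition_matrix p \<Delta> = (\<chi> s s'. \<Sum>a\<in>UNIV. pmf (p s a) s' * pmf (\<Delta> s) a)"

primrec matrix_power :: "real ^ 's ^ 's \<Rightarrow> nat \<Rightarrow> real ^ 's ^ ('s::finite)" where
  "matrix_power M 0 = mat 1"
| "matrix_power M (Suc n) = matrix_power M n ** M"

text \<open>
  \<open>first_passage M t n s\<close> is the probability that the chain with transition matrix \<open>M\<close> started
  in \<open>s\<close> visits \<open>t\<close> for the first time after time \<open>0\<close> at time \<open>n + 1\<close>. A state is transient
  if the probability of ever returning to it is less than one.
\<close>

primrec first_passage :: "real ^ 's ^ 's \<Rightarrow> 's \<Rightarrow> nat \<Rightarrow> ('s::finite) \<Rightarrow> real" where
  "first_passage M t 0 s = M $ s $ t"
| "first_passage M t (Suc n) s = (\<Sum>y\<in>UNIV - {t}. M $ s $ y * first_passage M t n y)"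

definition transient :: "real ^ 's ^ 's \<Rightarrow> ('s::finite) \<Rightarrow> bool" where
  "transient M s \<longleftrightarrow> (\<Sum>n. ennreal (first_passage M s n s)) < 1"

definition weakly_communicating ::
    "'a pmf set \<Rightarrow> ('s \<Rightarrow> 'a \<Rightarrow> ('s::finite) pmf) \<Rightarrow> bool" where
  "weakly_communicating Q p \<longleftrightarrow>
     (\<exists>C. (\<forall>s\<in>C. \<forall>s'\<in>C. \<exists>\<Delta>\<in>decision_rules Q. \<exists>N\<ge>1.
               matrix_power (transition_matrix p \<Delta>) N $ s $ s' > 0) \<and>
          (\<forall>s\<in>- C. \<forall>\<Delta>\<in>decision_rules Q. transient (transition_matrix p \<Delta>) s))"

definition weakly_communicating_adversary ::
    "'a pmf set \<Rightarrow> ('s \<Rightarrow> ('a \<Rightarrow> ('s::finite) pmf) set) \<Rightarrow> bool" where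
  "weakly_communicating_adversary Q P \<longleftrightarrow> (\<forall>p\<in>kernels P. weakly_communicating Q p)"

definition inf_sup_solution ::
    "('s \<Rightarrow> 'a \<Rightarrow> real) \<Rightarrow> 'a pmf set \<Rightarrow> ('s \<Rightarrow> ('a \<Rightarrow> 's pmf) set) \<Rightarrow>
      ('s::finite \<Rightarrow> real) \<Rightarrow> real \<Rightarrow> bool" where
  "inf_sup_solution r Q P u \<alpha> \<longleftrightarrow>
     (\<forall>s. ereal (u s) =
        (INF ps\<in>P s. SUP \<phi>\<in>Q.
           ereal (\<Sum>a\<in>UNIV. \<Sum>s'\<in>UNIV. pmf \<phi> a * pmf (ps a) s' * (r s a - \<alpha> + u s'))))"

end

theory Submission
  imports Defs "HOL-Real_Asymp.Real_Asymp"
begin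

text \<open>
  The controller learns. Against a fixed weakly communicating kernel \<open>p\<close> the optimal gain is the
  same number \<open>\<alpha>\<close> for every initial state, and up to any \<open>\<epsilon>\<close> it is attained by a deterministic
  stationary policy: by \<open>approximate_average_optimality\<close> there are \<open>u\<close> and \<open>d\<close> that solve the
  average-reward optimality equation up to \<open>\<epsilon>\<close>. Summing this relation along histories bounds the
  upper gain of all history-dependent policies by \<open>\<alpha> + \<epsilon>\<close> and the lower gain of \<open>d\<close> by
  \<open>\<alpha> - \<epsilon>\<close> from below. So for each \<open>p\<close> the four suprema over policies, with lower or upper gains
  and with stationary or history-dependent policies, agree. Call their infimum over all kernels \<open>G\<close>.

  By weak duality it remains to find, for each real \<open>c < G\<close>, one policy that guarantees \<open>c\<close> against
  all kernels at once, without knowing which one it faces. Since \<open>c\<close> is known, no estimation is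
  needed: the controller runs through the finitely many deterministic decision rules cyclically,
  plays each of them as long as the collected reward does not fall too far below \<open>c\<close> per step,
  and then moves to the next, with a growing tolerance. For every \<open>p\<close> there is a rule \<open>d\<close> whose
  gain exceeds \<open>c\<close> from every state. Each attempt with \<open>d\<close> fails with a probability that is
  exponentially small in its budget, so the expected tolerance used up stays bounded, and so does
  the regret with respect to \<open>c\<close>. This is \<open>satisficing_policy_regret_bounded\<close>; the bound may
  depend on \<open>p\<close>, but the gain does not see it.

  Finally, a solution \<open>(u, \<alpha>)\<close> of the inf-sup equation is a subsolution of the optimality equation
  of every kernel, and up to \<open>\<epsilon>\<close> a supersolution for some kernel, which gives \<open>G = \<alpha>\<close>.
\<close>

section \<open>Recurrent states in closed sets\<close>

lemma average_le_min_imp_eq: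
  fixes w v :: "'s::finite \<Rightarrow> real"
  assumes "\<And>y. 0 \<le> w y" "(\<Sum>y\<in>UNIV. w y) = 1" "\<And>y. 0 < w y \<Longrightarrow> m \<le> v y"
    and "(\<Sum>y\<in>UNIV. w y * v y) \<le> m" "0 < w y"
  shows "v y = m"
proof -
  have nn: "0 \<le> w y * (v y - m)" for y
    using assms(1)[of y] assms(3)[of y] by (cases "w y = 0") auto
  have "(\<Sum>y\<in>UNIV. w y * (v y - m)) = (\<Sum>y\<in>UNIV. w y * v y) - m"
    by (simp add: right_diff_distrib sum_subtractf assms(2) flip: sum_distrib_right)
  also have "\<dots> \<le> 0"
    using assms(4) by simp
  finally have "(\<Sum>y\<in>UNIV. w y * (v y - m)) = 0"
    using nn by (simp add: order_antisym sum_nonneg)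
  then have "w y * (v y - m) = 0"
    using nn by (subst (asm) sum_nonneg_eq_0_iff) auto
  with assms(5) show ?thesis
    by simp
qed

definition stochastic :: "real ^ 's ^ 's \<Rightarrow> bool" where
  "stochastic M \<longleftrightarrow> (\<forall>s y. 0 \<le> M $ s $ (y::'s::finite)) \<and> (\<forall>s. (\<Sum>y\<in>UNIV. M $ s $ y) = 1)"

definition closed_states :: "real ^ 's ^ 's \<Rightarrow> ('s::finite) set \<Rightarrow> bool" where
  "closed_states M R \<longleftrightarrow> (\<forall>s\<in>R. \<forall>y. 0 < M $ s $ y \<longrightarrow> y \<in> R)"

lemma first_passage_nonneg:
  "stochastic M \<Longrightarrow> 0 \<le> first_passage M t n s"
  by (induction n arbitrary: s) (auto simp: stochastic_def intro!: sum_nonneg mult_nonneg_nonneg)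

lemma sum_first_passage_le_1:
  assumes M: "stochastic M"
  shows "(\<Sum>n<k. first_passage M t n s) \<le> 1"
proof (induction k arbitrary: s)
  case (Suc k)
  have "(\<Sum>n<Suc k. first_passage M t n s)
      = M $ s $ t + (\<Sum>y\<in>UNIV - {t}. M $ s $ y * (\<Sum>n<k. first_passage M t n y))"
    unfolding sum.lessThan_Suc_shift sum_distrib_left first_passage.simps by (subst sum.swap) (simp add: sum_distrib_left)
  also have "\<dots> \<le> M $ s $ t + (\<Sum>y\<in>UNIV - {t}. M $ s $ y * 1)"
    using M Suc unfolding stochastic_def
    by (intro add_left_mono sum_mono mult_left_mono) auto
  also have "\<dots> = (\<Sum>y\<in>UNIV. M $ s $ y)"
    by (subst (2) sum.remove[of _ t]) auto
  finally show ?case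
    using M by (simp add: stochastic_def)
qed simp

lemma summable_first_passage:
  assumes "stochastic M"
  shows "summable (\<lambda>n. first_passage M t n s)"
proof (rule summableI_nonneg_bounded)
  show "(\<Sum>n<k. first_passage M t n s) \<le> 1" for k
    by (rule sum_first_passage_le_1[OF assms])
qed (rule first_passage_nonneg[OF assms])

text \<open>
  First-step analysis. Reaching \<open>t\<close> counts as success, which is why \<open>t\<close> carries the value \<open>1\<close>
  and not its own return probability.
\<close>

lemma hitting_probability_equation:
  assumes "stochastic M"
  shows "(\<Sum>n. first_passage M t n s)
    = (\<Sum>y\<in>UNIV. M $ s $ y * (if y = t then 1 else \<Sum>n. first_passage M t n y))"
proof -
  note sm = summable_first_passage[OF assms]
  have "(\<Sum>n. first_passage M t n s) = (\<Sum>n. first_passage M t (Suc n) s) + M $ s $ t"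
    using suminf_split_head[OF sm, of t s] by simp
  also have "(\<Sum>n. first_passage M t (Suc n) s)
      = (\<Sum>y\<in>UNIV - {t}. M $ s $ y * (\<Sum>n. first_passage M t n y))"
    by (simp add: suminf_sum suminf_mult sm summable_mult)
  also have "\<dots> + M $ s $ t
      = (\<Sum>y\<in>UNIV. M $ s $ y * (if y = t then 1 else \<Sum>n. first_passage M t n y))"
    by (subst (2) sum.remove[of _ t]) (auto intro: sum.cong)
  finally show ?thesis .
qed

lemma stochastic_successor:
  assumes "stochastic M"
  shows "\<exists>y. 0 < M $ s $ y"
proof (rule ccontr)
  assume "\<not> ?thesis"
  then have "(\<Sum>y\<in>UNIV. M $ s $ y) \<le> 0"
    by (intro sum_nonpos) (auto simp: not_less)
  with assms show False
    by (simp add: stochastic_def)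
qed

text \<open>
  A minimal nonempty closed subset \<open>K\<close> of \<open>R\<close> is irreducible, and each of its states \<open>t\<close> is
  recurrent: by first-step analysis, the states of \<open>K\<close> at which the probability of hitting \<open>t\<close>
  attains a minimum below \<open>1\<close> would only lead to states of the same kind other than \<open>t\<close>. They
  would form a closed set, hence be all of \<open>K\<close>, and then \<open>K - {t}\<close> would be a smaller closed set.
\<close>

lemma closed_states_contain_nontransient:
  assumes M: "stochastic M" and R: "R \<noteq> {}" "closed_states M R"
  shows "\<exists>t\<in>R. \<not> transient M t"
proof -
  obtain K where K: "K \<noteq> {} \<and> K \<subseteq> R \<and> closed_states M K"
      and Kmin: "\<And>L. L \<noteq> {} \<and> L \<subseteq> R \<and> closed_states M L \<Longrightarrow> card K \<le> card L"
    using ex_has_least_nat[of "\<lambda>K. K \<noteq> {} \<and> K \<subseteq> R \<and> closed_states M K" R card] R by blast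
  \<comment> \<open>\<open>K\<close> is chosen of least cardinality, which makes it minimal under inclusion.\<close>
  have minimal: "L = K" if "L \<noteq> {}" "L \<subseteq> K" "closed_states M L" for L
  proof (rule card_subset_eq)
    have "card K \<le> card L"
      using K that by (intro Kmin) auto
    moreover have "card L \<le> card K"
      using that by (intro card_mono) auto
    ultimately show "card L = card K"
      by simp
  qed (use that in auto)
  obtain t where t: "t \<in> K"
    using K by blast
  define f where "f s = (\<Sum>n. first_passage M t n s)" for s
  have f: "f s = (\<Sum>y\<in>UNIV. M $ s $ y * (if y = t then 1 else f y))" for s
    unfolding f_def by (rule hitting_probability_equation[OF M])
  define m where "m = Min (f ` K)"
  have m_le: "m \<le> f y" if "y \<in> K" for y
    using that by (simp add: m_def)
  have "m \<ge> 1"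
  proof (rule ccontr)
    assume m1: "\<not> m \<ge> 1"
    define Z where "Z = {s\<in>K. f s = m}"
    have "m \<in> f ` K"
      using K by (simp add: m_def)
    then have "Z \<noteq> {}"
      by (auto simp: Z_def)
    have succ: "y \<noteq> t \<and> y \<in> Z" if s: "s \<in> Z" and y: "0 < M $ s $ y" for s y
    proof -
      have "s \<in> K" "f s = m"
        using s by (auto simp: Z_def)
      have inK: "z \<in> K" if "0 < M $ s $ z" for z
        using K \<open>s \<in> K\<close> that by (auto simp: closed_states_def)
      have "(if y = t then 1 else f y) = m"
      proof (rule average_le_min_imp_eq[where w = "\<lambda>y. M $ s $ y"])
        show "m \<le> (if z = t then 1 else f z)" if "0 < M $ s $ z" for z
          using inK[OF that] m_le m1 by auto
        show "(\<Sum>y\<in>UNIV. M $ s $ y * (if y = t then 1 else f y)) \<le> m"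
          using f[of s] \<open>f s = m\<close> by simp
      qed (use M y in \<open>auto simp: stochastic_def\<close>)
      then show ?thesis
        using m1 inK[OF y] by (auto simp: Z_def split: if_splits)
    qed
    have "Z = K"
    proof (rule minimal)
      show "Z \<subseteq> K"
        by (auto simp: Z_def)
      show "closed_states M Z"
        unfolding closed_states_def using succ by blast
    qed fact
    have "K - {t} = K"
    proof (rule minimal)
      show "K - {t} \<noteq> {}"
        using stochastic_successor[OF M, of t] succ t unfolding \<open>Z = K\<close> by blast
      show "closed_states M (K - {t})"
        using succ unfolding \<open>Z = K\<close> closed_states_def by blast
    qed auto
    with t show False
      by blast
  qed
  then have "1 \<le> f t"
    using m_le[OF t] by simp
  then have "\<not> transient M t"
    unfolding transient_def f_def
    by (subst suminf_ennreal2[OF first_passage_nonneg[OF M] summable_first_passage[OF M]])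
      (simp add: not_less)
  with t K show ?thesis
    by blast
qed

lemma matrix_power_closed_states:
  assumes "\<And>s y. 0 \<le> M $ s $ y" "closed_states M R" "s \<in> R" "0 < matrix_power M n $ s $ y"
  shows "y \<in> R"
proof -
  have "matrix_power M n $ s $ y = 0" if "y \<notin> R" for y
    using that
  proof (induction n arbitrary: y)
    case 0
    then show ?case
      using assms(3) by (auto simp: mat_def)
  next
    case (Suc n)
    have "matrix_power M n $ s $ z * M $ z $ y = 0" for z
      using Suc assms(1)[of z y] assms(2) by (cases "z \<in> R") (auto simp: closed_states_def)
    then show ?case
      by (auto simp: matrix_matrix_mult_def intro!: sum.neutral)
  qed
  with assms(4) show ?thesis
    by (cases "y \<in> R") auto
qed

lemma transition_matrix_deterministic:
  fixes d :: "'s::finite \<Rightarrow> 'a::finite"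
  shows "transition_matrix p (\<lambda>s. return_pmf (d s)) $ s $ y = pmf (p s (d s)) y"
proof -
  have "transition_matrix p (\<lambda>s. return_pmf (d s)) $ s $ y
      = (\<Sum>a\<in>UNIV. if a = d s then pmf (p s a) y else 0)"
    by (auto simp: transition_matrix_def pmf_return intro!: sum.cong)
  then show ?thesis
    by simp
qed

lemma sum_pmf_finite_type: "(\<Sum>y\<in>UNIV. pmf q (y::'s::finite)) = 1"
  by (rule sum_pmf_eq_1) auto

lemma stochastic_deterministic:
  "stochastic (transition_matrix p (\<lambda>s. return_pmf ((d::'s::finite \<Rightarrow> 'a::finite) s)))"
  by (simp add: stochastic_def transition_matrix_deterministic sum_pmf_finite_type)

section \<open>The average-reward optimality equation\<close>

text \<open>
  The expectation, written as a finite sum so that linearity and limits need no integrability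
  conditions.
\<close>

definition mean :: "'s::finite pmf \<Rightarrow> ('s \<Rightarrow> real) \<Rightarrow> real" where
  "mean q v = (\<Sum>y\<in>UNIV. pmf q y * v y)"

lemma mean_const [simp]: "mean q (\<lambda>_. c) = c"
  by (simp add: mean_def sum_pmf_finite_type flip: sum_distrib_right)

lemma mean_return [simp]: "mean (return_pmf x) v = v x"
proof -
  have "mean (return_pmf x) v = (\<Sum>y\<in>UNIV. if y = x then v y else 0)"
    unfolding mean_def by (intro sum.cong) (auto simp: pmf_return)
  then show ?thesis
    by simp
qed

lemma mean_mono: "(\<And>y. v y \<le> w y) \<Longrightarrow> mean q v \<le> mean q w"
  by (simp add: mean_def sum_mono mult_left_mono)

lemma mean_add: "mean q (\<lambda>y. v y + w y) = mean q v + mean q w"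
  by (simp add: mean_def sum.distrib algebra_simps)

lemma mean_cmult: "mean q (\<lambda>y. c * v y) = c * mean q v"
  by (simp add: mean_def sum_distrib_left algebra_simps)

lemma mean_uminus: "mean q (\<lambda>y. - v y) = - mean q v"
  using mean_cmult[of q "-1" v] by simp

lemma tendsto_mean:
  "(\<And>y. ((\<lambda>k. v k y) \<longlongrightarrow> l y) F) \<Longrightarrow> ((\<lambda>k. mean q (v k)) \<longlongrightarrow> mean q l) F"
  unfolding mean_def by (intro tendsto_intros)

lemma mean_le_min_imp_eq:
  assumes "\<And>y. m \<le> v y" "mean q v \<le> m" "0 < pmf q y"
  shows "v y = m"
  by (rule average_le_min_imp_eq[where w = "pmf q"])
    (use assms in \<open>auto simp: mean_def sum_pmf_finite_type\<close>)

text \<open>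
  Value iteration from \<open>0\<close> is increasing and bounded by \<open>1 / (1 - g)\<close>; its limit is the solution.
\<close>

lemma discounted_optimality_equation:
  fixes r :: "'s::finite \<Rightarrow> 'a::finite \<Rightarrow> real"
  assumes r: "\<And>s a. r s a \<in> {0..1}" and g: "0 \<le> g" "g < 1"
  obtains v where "\<And>s. 0 \<le> v s" "\<And>s. v s \<le> 1 / (1 - g)"
    "\<And>s a. r s a + g * mean (p s a) v \<le> v s"
    "\<And>s. \<exists>a. v s \<le> r s a + g * mean (p s a) v"
proof -
  define T where "T v s = Max (range (\<lambda>a. r s a + g * mean (p s a) v))" for v s
  define w where "w n = (T ^^ n) (\<lambda>_. 0)" for n
  have w_0: "w 0 s = 0" and w_Suc: "w (Suc n) = T (w n)" for n s
    by (simp_all add: w_def)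
  have T_ge: "r s a + g * mean (p s a) v \<le> T v s" for v s a
    by (simp add: T_def)
  have T_attained: "\<exists>a. T v s = r s a + g * mean (p s a) v" for v s
  proof -
    have "T v s \<in> range (\<lambda>a. r s a + g * mean (p s a) v)"
      unfolding T_def by (rule Max_in) auto
    then show ?thesis
      by blast
  qed
  have T_mono: "T v s \<le> T v' s" if "\<And>y. v y \<le> v' y" for v v' s
  proof -
    obtain a where "T v s = r s a + g * mean (p s a) v"
      using T_attained by blast
    also have "\<dots> \<le> r s a + g * mean (p s a) v'"
      using g that by (intro add_left_mono mult_left_mono mean_mono) auto
    also have "\<dots> \<le> T v' s"
      by (rule T_ge)
    finally show ?thesis .
  qed
  have bounds: "0 \<le> w n s \<and> w n s \<le> 1 / (1 - g)" for n s
  proof (induction n arbitrary: s)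
    case 0
    then show ?case
      using g by (simp add: w_0)
  next
    case (Suc n)
    obtain a where a: "w (Suc n) s = r s a + g * mean (p s a) (w n)"
      using T_attained[of "w n" s] unfolding w_Suc by blast
    have "0 \<le> mean (p s a) (w n)" "mean (p s a) (w n) \<le> 1 / (1 - g)"
      using mean_mono[of "\<lambda>_. 0" "w n" "p s a"] mean_mono[of "w n" "\<lambda>_. 1 / (1 - g)" "p s a"]
        Suc by auto
    then have "0 \<le> g * mean (p s a) (w n)" "g * mean (p s a) (w n) \<le> g * (1 / (1 - g))"
      using g by (auto intro: mult_left_mono simp del: times_divide_eq_right)
    moreover have "1 + g * (1 / (1 - g)) = 1 / (1 - g)"
      using g by (simp add: field_simps)
    ultimately show ?case
      unfolding a using r[of s a] by auto
  qed
  have incr: "w n s \<le> w (Suc n) s" for n s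
  proof (induction n arbitrary: s)
    case 0
    then show ?case
      using bounds[of "Suc 0" s] by (simp add: w_0)
  next
    case (Suc n)
    show ?case
      using T_mono[OF Suc] by (simp add: w_Suc)
  qed
  define v where "v s = (SUP n. w n s)" for s
  have bdd: "bdd_above (range (\<lambda>n. w n s))" for s
    using bounds by (intro bdd_aboveI[of _ "1 / (1 - g)"]) auto
  have lim: "(\<lambda>n. w n s) \<longlonglongrightarrow> v s" for s
    unfolding v_def by (rule LIMSEQ_incseq_SUP[OF bdd]) (rule incseq_SucI, rule incr)
  have w_le_v: "w n s \<le> v s" for n s
    unfolding v_def by (rule cSUP_upper[OF _ bdd]) simp
  show ?thesis
  proof
    show "0 \<le> v s" for s
      using w_le_v[of 0 s] by (simp add: w_0)
    show "v s \<le> 1 / (1 - g)" for s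
      using bounds by (intro LIMSEQ_le_const2[OF lim]) auto
    show "r s a + g * mean (p s a) v \<le> v s" for s a
    proof (rule LIMSEQ_le_const2)
      show "(\<lambda>n. r s a + g * mean (p s a) (w n)) \<longlonglongrightarrow> r s a + g * mean (p s a) v"
        by (intro tendsto_intros tendsto_mean lim)
      have "r s a + g * mean (p s a) (w n) \<le> v s" for n
        using T_ge[of s a "w n"] w_le_v[of "Suc n" s] unfolding w_Suc by (rule order_trans)
      then show "\<exists>N. \<forall>n\<ge>N. r s a + g * mean (p s a) (w n) \<le> v s"
        by blast
    qed
    show "\<exists>a. v s \<le> r s a + g * mean (p s a) v" for s
    proof -
      have "w (Suc n) s \<le> T v s" for n
        unfolding w_Suc by (rule T_mono) (rule w_le_v)
      then have "v s \<le> T v s"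
        by (intro LIMSEQ_le_const2[OF LIMSEQ_Suc[OF lim]]) auto
      with T_attained[of v s] show ?thesis
        by auto
    qed
  qed
qed

text \<open>
  The minimum of \<open>w\<close> propagates to the successors of a state under every action, its maximum to
  the successors under a maximizing action \<open>d\<close>. So the argmin and the argmax are both closed for
  the chain of \<open>d\<close> and contain a nontransient state, which has to lie in the communicating class
  \<open>C\<close>. From the argmin in \<open>C\<close> one can travel to the argmax in \<open>C\<close>, and the minimum is preserved
  on the way.
\<close>

lemma weakly_communicating_harmonic_constant:
  fixes p :: "'s::finite \<Rightarrow> 'a::finite \<Rightarrow> 's pmf"
  assumes Q: "range return_pmf \<subseteq> Q" and wc: "weakly_communicating Q p"
    and super: "\<And>s a. mean (p s a) w \<le> w s"
    and attained: "\<And>s. \<exists>a. w s \<le> mean (p s a) w"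
  shows "w s = w s'"
proof -
  from wc obtain C where comm: "\<forall>s\<in>C. \<forall>s'\<in>C. \<exists>\<Delta>\<in>decision_rules Q. \<exists>N\<ge>1.
        0 < matrix_power (transition_matrix p \<Delta>) N $ s $ s'"
    and trans: "\<forall>s\<in>- C. \<forall>\<Delta>\<in>decision_rules Q. transient (transition_matrix p \<Delta>) s"
    unfolding weakly_communicating_def by (elim exE conjE)
  obtain d where d: "\<And>s. w s \<le> mean (p s (d s)) w"
    using attained by metis
  let ?M = "transition_matrix p (\<lambda>s. return_pmf (d s))"
  have meets_C: "R \<inter> C \<noteq> {}" if R: "R \<noteq> {}" "closed_states ?M R" for R
  proof -
    obtain t where "t \<in> R" "\<not> transient ?M t"
      using closed_states_contain_nontransient[OF stochastic_deterministic R] by blast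
    moreover have "(\<lambda>s. return_pmf (d s)) \<in> decision_rules Q"
      using Q by (auto simp: decision_rules_def)
    ultimately show ?thesis
      using trans by blast
  qed
  define lo where "lo = Min (range w)"
  define hi where "hi = Max (range w)"
  have lo: "lo \<le> w y" and hi: "w y \<le> hi" for y
    by (simp_all add: lo_def hi_def)
  have lo_succ: "w y = lo" if "w s = lo" "0 < pmf (p s a) y" for s a y
    using mean_le_min_imp_eq[of lo w "p s a" y] lo super[of s a] that by simp
  have hi_succ: "w y = hi" if "w s = hi" "0 < pmf (p s (d s)) y" for s y
    using mean_le_min_imp_eq[of "- hi" "\<lambda>y. - w y" "p s (d s)" y] hi d[of s] that
    by (simp add: mean_uminus)
  have "lo \<in> range w"
    unfolding lo_def by (rule Min_in) auto
  then obtain s_lo where "w s_lo = lo"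
    by (metis rangeE)
  have "hi \<in> range w"
    unfolding hi_def by (rule Max_in) auto
  then obtain s_hi where "w s_hi = hi"
    by (metis rangeE)
  have "closed_states ?M {s. w s = lo}"
    unfolding closed_states_def transition_matrix_deterministic
    using lo_succ by simp
  with \<open>w s_lo = lo\<close> have "{s. w s = lo} \<inter> C \<noteq> {}"
    by (intro meets_C) auto
  moreover have "closed_states ?M {s. w s = hi}"
    unfolding closed_states_def transition_matrix_deterministic
    using hi_succ by simp
  with \<open>w s_hi = hi\<close> have "{s. w s = hi} \<inter> C \<noteq> {}"
    by (intro meets_C) auto
  ultimately obtain x y where x: "x \<in> C" "w x = lo" and y: "y \<in> C" "w y = hi"
    by blast
  obtain \<Delta> N where "0 < matrix_power (transition_matrix p \<Delta>) N $ x $ y"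
    using comm x(1) y(1) by blast
  moreover have "closed_states (transition_matrix p \<Delta>) {s. w s = lo}"
    unfolding closed_states_def
  proof (intro ballI allI impI)
    fix s y assume s: "s \<in> {s. w s = lo}" and "0 < transition_matrix p \<Delta> $ s $ y"
    then have "(\<Sum>a\<in>UNIV. pmf (p s a) y * pmf (\<Delta> s) a) \<noteq> 0"
      by (simp add: transition_matrix_def)
    then obtain a where "pmf (p s a) y * pmf (\<Delta> s) a \<noteq> 0"
      using sum.not_neutral_contains_not_neutral by blast
    then show "y \<in> {s. w s = lo}"
      using lo_succ[of s a y] s by (simp add: less_le)
  qed
  ultimately have "y \<in> {s. w s = lo}"
    using x(2) matrix_power_closed_states[of "transition_matrix p \<Delta>" "{s. w s = lo}" x N y]
    by (simp add: transition_matrix_def sum_nonneg)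
  then have "lo = hi"
    using y by simp
  then show ?thesis
    using lo[of s] hi[of s] lo[of s'] hi[of s'] by simp
qed

text \<open>
  Vanishing discount. The normalized discounted values \<open>w = (1 - g) v\<close> stay in the unit cube, and
  every limit point for \<open>g \<longlongrightarrow> 1\<close> solves \<open>w s = max a. mean (p s a) w\<close>, hence is a constant
  \<open>\<alpha>\<close>. Since the discounted equation reads \<open>v s + mean (p s a) w = r s a + mean (p s a) v\<close> for a
  maximizing \<open>a\<close>, as soon as \<open>w\<close> is uniformly \<open>\<epsilon>\<close>-close to \<open>\<alpha>\<close>, the function \<open>v\<close> solves the
  average-reward optimality equation up to \<open>\<epsilon>\<close>. As
  \<open>\<epsilon>\<close> becomes small, the two inequalities determine the optimal gain.
\<close>

lemma approximate_average_optimality: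
  fixes r :: "'s::finite \<Rightarrow> 'a::finite \<Rightarrow> real"
  assumes r: "\<And>s a. r s a \<in> {0..1}"
    and Q: "range return_pmf \<subseteq> Q" and wc: "weakly_communicating Q p" and e: "0 < \<epsilon>"
  obtains \<alpha> u d where
    "\<And>s a. r s a + mean (p s a) u \<le> u s + (\<alpha> + \<epsilon>)"
    "\<And>s. u s + (\<alpha> - \<epsilon>) \<le> r s (d s) + mean (p s (d s)) u"
proof -
  define g where "g k = 1 - inverse (real (Suc k))" for k
  have g: "0 \<le> g k" "g k < 1" for k
    by (simp_all add: g_def field_simps)
  have "\<exists>v. (\<forall>s. 0 \<le> v s) \<and> (\<forall>s. v s \<le> 1 / (1 - g k)) \<and>
      (\<forall>s a. r s a + g k * mean (p s a) v \<le> v s) \<and>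
      (\<forall>s. \<exists>a. v s \<le> r s a + g k * mean (p s a) v)" for k
    by (rule discounted_optimality_equation[where r = r and p = p, OF r g[of k]]) blast
  then obtain v where v0: "\<And>k s. 0 \<le> v k s" and v1: "\<And>k s. v k s \<le> 1 / (1 - g k)"
    and v_ge: "\<And>k s a. r s a + g k * mean (p s a) (v k) \<le> v k s"
    and v_le: "\<And>k s. \<exists>a. v k s \<le> r s a + g k * mean (p s a) (v k)"
    by metis
  define w where "w k s = (1 - g k) * v k s" for k s
  have w0: "0 \<le> w k s" and w1: "w k s \<le> 1" for k s
    using g[of k] v0[of k s] v1[of k s] by (simp_all add: w_def pos_le_divide_eq mult.commute)
  have w_mean: "mean q (w k) = (1 - g k) * mean q (v k)" for q k
    unfolding w_def by (rule mean_cmult)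
  have w_ge: "(1 - g k) * r s a + g k * mean (p s a) (w k) \<le> w k s" for k s a
    using mult_left_mono[OF v_ge[of s a k], of "1 - g k"] g[of k]
    by (simp add: w_mean w_def[of k s] algebra_simps)
  have w_le: "\<exists>a. w k s \<le> (1 - g k) * r s a + g k * mean (p s a) (w k)" for k s
  proof -
    obtain a where "v k s \<le> r s a + g k * mean (p s a) (v k)"
      using v_le by blast
    from mult_left_mono[OF this, of "1 - g k"] g[of k] show ?thesis
      by (intro exI[of _ a]) (simp add: w_mean w_def[of k s] algebra_simps)
  qed
  have "seq_compact (cbox 0 1 :: (real ^ 's) set)"
    by (intro compact_imp_seq_compact compact_cbox)
  moreover have "\<forall>k. (\<chi> s. w k s) \<in> cbox 0 1"
    using w0 w1 by (simp add: mem_box_cart)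
  ultimately obtain l :: "real ^ 's" and \<sigma> where \<sigma>: "strict_mono (\<sigma> :: nat \<Rightarrow> nat)"
    and "((\<lambda>k. \<chi> s. w k s) \<circ> \<sigma>) \<longlonglongrightarrow> l"
    by (rule seq_compactE)
  then have lim: "(\<lambda>k. w (\<sigma> k) s) \<longlonglongrightarrow> l $ s" for s
    using tendsto_vec_nth[of "(\<lambda>k. \<chi> s. w k s) \<circ> \<sigma>" l sequentially s] by (simp add: o_def)
  have "g \<longlonglongrightarrow> 1 - 0"
    unfolding g_def by (intro tendsto_intros LIMSEQ_inverse_real_of_nat)
  then have g_lim: "(\<lambda>k. g (\<sigma> k)) \<longlonglongrightarrow> 1"
    using LIMSEQ_subseq_LIMSEQ[OF _ \<sigma>] by (fastforce simp: o_def)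
  have rhs_lim: "(\<lambda>k. (1 - g (\<sigma> k)) * r s a + g (\<sigma> k) * mean (p s a) (w (\<sigma> k)))
      \<longlonglongrightarrow> mean (p s a) (($) l)" for s a
  proof -
    have "(\<lambda>k. (1 - g (\<sigma> k)) * r s a + g (\<sigma> k) * mean (p s a) (w (\<sigma> k)))
        \<longlonglongrightarrow> (1 - 1) * r s a + 1 * mean (p s a) (($) l)"
      by (intro tendsto_intros tendsto_mean g_lim lim)
    then show ?thesis
      by simp
  qed
  have const: "l $ s = l $ s'" for s s'
  proof (rule weakly_communicating_harmonic_constant[OF Q wc, of "($) l"])
    show "mean (p s a) (($) l) \<le> l $ s" for s a
      by (rule LIMSEQ_le[OF rhs_lim lim]) (use w_ge in blast)
    show "\<exists>a. l $ s \<le> mean (p s a) (($) l)" for s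
    proof (rule ccontr)
      assume "\<not> ?thesis"
      then have neg: "mean (p s a) (($) l) - l $ s < 0" for a
        by (simp add: not_le)
      have "\<forall>a. \<forall>\<^sub>F k in sequentially.
          (1 - g (\<sigma> k)) * r s a + g (\<sigma> k) * mean (p s a) (w (\<sigma> k)) - w (\<sigma> k) s < 0"
        by (intro allI order_tendstoD(2)[OF tendsto_diff[OF rhs_lim lim] neg])
      then have "\<forall>\<^sub>F k in sequentially. \<forall>a.
          (1 - g (\<sigma> k)) * r s a + g (\<sigma> k) * mean (p s a) (w (\<sigma> k)) < w (\<sigma> k) s"
        by (simp add: eventually_all_finite)
      then obtain k where "\<And>a. (1 - g (\<sigma> k)) * r s a + g (\<sigma> k) * mean (p s a) (w (\<sigma> k)) < w (\<sigma> k) s"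
        using eventually_happens'[OF sequentially_bot] by blast
      then show False
        using w_le[of "\<sigma> k" s] by (auto simp: not_le[symmetric])
    qed
  qed
  define \<alpha> where "\<alpha> = l $ undefined"
  have l_eq: "l $ s = \<alpha>" for s
    unfolding \<alpha>_def by (rule const)
  have "\<forall>s. \<forall>\<^sub>F k in sequentially. dist (w (\<sigma> k) s) \<alpha> < \<epsilon>"
    using lim e unfolding l_eq tendsto_iff by simp
  then have "\<forall>\<^sub>F k in sequentially. \<forall>s. dist (w (\<sigma> k) s) \<alpha> < \<epsilon>"
    by (simp add: eventually_all_finite)
  then obtain k where k: "\<And>s. dist (w k s) \<alpha> < \<epsilon>"
    using eventually_happens'[OF sequentially_bot] by blast
  have "w k s \<le> \<alpha> + \<epsilon>" "\<alpha> - \<epsilon> \<le> w k s" for s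
    using k[of s] by (auto simp: dist_real_def abs_less_iff)
  then have near: "mean q (w k) \<le> \<alpha> + \<epsilon>" "\<alpha> - \<epsilon> \<le> mean q (w k)" for q
    using mean_mono[of "w k" "\<lambda>_. \<alpha> + \<epsilon>" q] mean_mono[of "\<lambda>_. \<alpha> - \<epsilon>" "w k" q] by simp_all
  have split: "mean q (v k) = g k * mean q (v k) + mean q (w k)" for q
    by (simp add: w_mean algebra_simps)
  obtain d where d: "\<And>s. v k s \<le> r s (d s) + g k * mean (p s (d s)) (v k)"
    using v_le by metis
  show ?thesis
  proof
    show "r s a + mean (p s a) (v k) \<le> v k s + (\<alpha> + \<epsilon>)" for s a
      using v_ge[of s a k] near(1)[of "p s a"] by (subst split) linarith
    show "v k s + (\<alpha> - \<epsilon>) \<le> r s (d s) + mean (p s (d s)) (v k)" for s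
      using d[of s] near(2)[of "p s (d s)"] by (subst split) linarith
  qed
qed

section \<open>Expectations along histories\<close>

lemma expectation_eq_mean:
  "measure_pmf.expectation (q :: 's::finite pmf) v = mean q v"
  by (subst integral_measure_pmf[of UNIV]) (auto simp: mean_def)

definition total_reward :: "('s \<Rightarrow> 'a \<Rightarrow> real) \<Rightarrow> ('s \<times> 'a) list \<Rightarrow> real" where
  "total_reward r h = (\<Sum>(s, a)\<leftarrow>h. r s a)"

lemma total_reward_snoc [simp]: "total_reward r (h @ [(s, a)]) = total_reward r h + r s a"
  and total_reward_Nil [simp]: "total_reward r [] = 0"
  by (simp_all add: total_reward_def)

definition history_expectation ::
    "'s pmf \<Rightarrow> ('s, 'a) policy \<Rightarrow> ('s, 'a) adversary \<Rightarrow> nat \<Rightarrow>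
      (('s \<times> 'a) list \<Rightarrow> 's \<Rightarrow> real) \<Rightarrow> real" where
  "history_expectation \<mu> \<pi> \<kappa> n f =
     measure_pmf.expectation (history_law \<mu> \<pi> \<kappa> n) (\<lambda>(h, s). f h s)"

context
  fixes \<mu> :: "'s::finite pmf" and \<pi> :: "('s, 'a::finite) policy" and \<kappa> :: "('s, 'a) adversary"
begin

lemma finite_history_law: "finite (set_pmf (history_law \<mu> \<pi> \<kappa> n))"
  by (induction n) (auto simp: case_prod_unfold)

lemma length_history_law: "(h, s) \<in> set_pmf (history_law \<mu> \<pi> \<kappa> n) \<Longrightarrow> length h = n"
  by (induction n arbitrary: h s) auto

lemma history_expectation_sum:
  "history_expectation \<mu> \<pi> \<kappa> n f
    = (\<Sum>(h, s)\<in>set_pmf (history_law \<mu> \<pi> \<kappa> n). pmf (history_law \<mu> \<pi> \<kappa> n) (h, s) * f h s)"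
  unfolding history_expectation_def
  by (subst integral_measure_pmf[OF finite_history_law]) (auto simp: case_prod_unfold)

lemma history_expectation_mono:
  assumes "\<And>h s. length h = n \<Longrightarrow> f h s \<le> g h s"
  shows "history_expectation \<mu> \<pi> \<kappa> n f \<le> history_expectation \<mu> \<pi> \<kappa> n g"
  unfolding history_expectation_sum
  by (rule sum_mono) (auto intro!: mult_left_mono assms dest: length_history_law)

lemma history_expectation_add:
  "history_expectation \<mu> \<pi> \<kappa> n (\<lambda>h s. f h s + g h s)
    = history_expectation \<mu> \<pi> \<kappa> n f + history_expectation \<mu> \<pi> \<kappa> n g"
  by (simp add: history_expectation_sum case_prod_unfold distrib_left sum.distrib)

lemma history_expectation_uminus:
  "history_expectation \<mu> \<pi> \<kappa> n (\<lambda>h s. - f h s) = - history_expectation \<mu> \<pi> \<kappa> n f"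
  by (simp add: history_expectation_sum case_prod_unfold sum_negf)

lemma history_expectation_const [simp]: "history_expectation \<mu> \<pi> \<kappa> n (\<lambda>h s. c) = c"
  by (simp add: history_expectation_def case_prod_unfold)

lemma history_expectation_0: "history_expectation \<mu> \<pi> \<kappa> 0 f = mean \<mu> (f [])"
  by (simp add: history_expectation_def expectation_eq_mean)

lemma history_expectation_Suc:
  "history_expectation \<mu> \<pi> \<kappa> (Suc n) f
    = history_expectation \<mu> \<pi> \<kappa> n
        (\<lambda>h s. mean (\<pi> h s) (\<lambda>a. mean (\<kappa> h s a) (f (h @ [(s, a)]))))"
proof -
  have step: "measure_pmf.expectation
        (bind_pmf (\<pi> h s) (\<lambda>a. map_pmf (\<lambda>s'. (h @ [(s, a)], s')) (\<kappa> h s a))) (\<lambda>(h, s). f h s)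
      = mean (\<pi> h s) (\<lambda>a. mean (\<kappa> h s a) (f (h @ [(s, a)])))" for h s
    by (subst pmf_expectation_bind[of UNIV]) (auto simp: mean_def[of "\<pi> h s"] expectation_eq_mean)
  show ?thesis
    unfolding history_expectation_sum[of n]
    unfolding history_expectation_def history_law.simps
    by (subst pmf_expectation_bind[OF finite_history_law])
      (auto simp: case_prod_unfold step[unfolded case_prod_unfold])
qed

text \<open>
  The finite-horizon form of the supermartingale property. Both the
  verification of gains and the regret bound of the search apply it to a suitable potential \<open>W\<close>.
\<close>

lemma history_expectation_drift_le:
  assumes "\<And>h s. mean (\<pi> h s) (\<lambda>a. mean (\<kappa> h s a) (W (h @ [(s, a)]))) \<le> W h s + c"
  shows "history_expectation \<mu> \<pi> \<kappa> n W \<le> mean \<mu> (W []) + real n * c"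
proof (induction n)
  case (Suc n)
  have "history_expectation \<mu> \<pi> \<kappa> (Suc n) W \<le> history_expectation \<mu> \<pi> \<kappa> n (\<lambda>h s. W h s + c)"
    unfolding history_expectation_Suc by (rule history_expectation_mono) (rule assms)
  also have "\<dots> = history_expectation \<mu> \<pi> \<kappa> n W + c"
    by (simp add: history_expectation_add)
  finally show ?case
    using Suc by (simp add: algebra_simps)
qed (simp add: history_expectation_0)

lemma average_reward_eq:
  "average_reward r \<mu> \<pi> \<kappa> n = history_expectation \<mu> \<pi> \<kappa> n (\<lambda>h s. total_reward r h) / real n"
proof -
  have "(\<Sum>k<n. r (fst (h ! k)) (snd (h ! k))) = total_reward r h"
    if "(h, s) \<in> set_pmf (history_law \<mu> \<pi> \<kappa> n)" for h s
    using length_history_law[OF that]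
    by (simp add: total_reward_def sum_list_sum_nth case_prod_unfold atLeast0LessThan)
  then have "average_reward r \<mu> \<pi> \<kappa> n
      = history_expectation \<mu> \<pi> \<kappa> n (\<lambda>h s. (1 / real n) * total_reward r h)"
    unfolding average_reward_def history_expectation_def
    by (intro integral_cong_AE) (auto simp: AE_measure_pmf_iff)
  then show ?thesis
    by (simp add: history_expectation_sum sum_divide_distrib case_prod_unfold)
qed

lemma lower_gain_le_upper_gain: "lower_gain r \<mu> \<pi> \<kappa> \<le> upper_gain r \<mu> \<pi> \<kappa>"
  unfolding lower_gain_def upper_gain_def by (intro Liminf_le_Limsup) simp

lemma upper_gain_leI:
  assumes "\<And>n. history_expectation \<mu> \<pi> \<kappa> n (\<lambda>h s. total_reward r h) \<le> real n * c + K"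
  shows "upper_gain r \<mu> \<pi> \<kappa> \<le> ereal c"
proof -
  have "\<forall>\<^sub>F n in sequentially. ereal (average_reward r \<mu> \<pi> \<kappa> n) \<le> ereal (c + K / real n)"
    using eventually_gt_at_top[of 0]
  proof eventually_elim
    case (elim n)
    then show ?case
      using divide_right_mono[OF assms[of n], of "real n"]
      by (simp add: average_reward_eq add_divide_distrib)
  qed
  then have "upper_gain r \<mu> \<pi> \<kappa> \<le> limsup (\<lambda>n. ereal (c + K / real n))"
    unfolding upper_gain_def by (rule Limsup_mono)
  also have "limsup (\<lambda>n. ereal (c + K / real n)) = ereal c"
  proof -
    have "(\<lambda>n. ereal (c + K / real n)) \<longlonglongrightarrow> ereal (c + 0)"
      by (intro tendsto_intros lim_const_over_n)
    from lim_imp_Limsup[OF _ this] show ?thesis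
      by simp
  qed
  finally show ?thesis .
qed

lemma lower_gain_geI:
  assumes "\<And>n. real n * c - K \<le> history_expectation \<mu> \<pi> \<kappa> n (\<lambda>h s. total_reward r h)"
  shows "ereal c \<le> lower_gain r \<mu> \<pi> \<kappa>"
proof -
  have "(\<lambda>n. ereal (c - K / real n)) \<longlonglongrightarrow> ereal (c - 0)"
    by (intro tendsto_intros lim_const_over_n)
  from lim_imp_Liminf[OF _ this] have "ereal c = liminf (\<lambda>n. ereal (c - K / real n))"
    by simp
  also have "\<forall>\<^sub>F n in sequentially. ereal (c - K / real n) \<le> ereal (average_reward r \<mu> \<pi> \<kappa> n)"
    using eventually_gt_at_top[of 0]
  proof eventually_elim
    case (elim n)
    then show ?case
      using divide_right_mono[OF assms[of n], of "real n"]
      by (simp add: average_reward_eq diff_divide_distrib)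
  qed
  then have "liminf (\<lambda>n. ereal (c - K / real n)) \<le> lower_gain r \<mu> \<pi> \<kappa>"
    unfolding lower_gain_def by (rule Liminf_mono)
  finally show ?thesis .
qed

end

text \<open>
  Verification: the accumulated reward plus \<open>u\<close> at the current state grows by at most \<open>c\<close> per
  step in expectation, whatever the controller does, and \<open>u\<close> is bounded.
\<close>

lemma upper_gain_le_of_superharmonic:
  fixes r :: "'s::finite \<Rightarrow> 'a::finite \<Rightarrow> real"
  assumes "\<And>s a. r s a + mean (p s a) u \<le> u s + c"
  shows "upper_gain r \<mu> \<pi> (\<lambda>h s a. p s a) \<le> ereal c"
proof (rule upper_gain_leI)
  fix n
  define m where "m = Min (range u)"
  have m: "m \<le> u s" for s
    by (simp add: m_def)
  let ?W = "\<lambda>h s. total_reward r h + u s"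
  have "history_expectation \<mu> \<pi> (\<lambda>h s a. p s a) n (\<lambda>h s. total_reward r h + m)
      \<le> history_expectation \<mu> \<pi> (\<lambda>h s a. p s a) n ?W"
    by (rule history_expectation_mono) (simp add: m)
  also have "\<dots> \<le> mean \<mu> (?W []) + real n * c"
  proof (rule history_expectation_drift_le)
    fix h s
    have "mean (\<pi> h s) (\<lambda>a. mean (p s a) (?W (h @ [(s, a)])))
        \<le> mean (\<pi> h s) (\<lambda>a. total_reward r h + u s + c)"
      by (rule mean_mono) (use assms in \<open>simp add: mean_add\<close>)
    then show "mean (\<pi> h s) (\<lambda>a. mean (p s a) (?W (h @ [(s, a)]))) \<le> ?W h s + c"
      by simp
  qed
  finally show "history_expectation \<mu> \<pi> (\<lambda>h s a. p s a) n (\<lambda>h s. total_reward r h)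
      \<le> real n * c + (mean \<mu> u - m)"
    by (simp add: history_expectation_add)
qed

lemma lower_gain_ge_of_subharmonic:
  fixes r :: "'s::finite \<Rightarrow> 'a::finite \<Rightarrow> real"
  assumes "\<And>s. u s + c \<le> r s (d s) + mean (p s (d s)) u"
  shows "ereal c \<le> lower_gain r \<mu> (\<lambda>h s. return_pmf (d s)) (\<lambda>h s a. p s a)"
proof (rule lower_gain_geI)
  fix n
  let ?E = "history_expectation \<mu> (\<lambda>h s. return_pmf (d s)) (\<lambda>h s a. p s a) n"
  define m where "m = Max (range u)"
  have m: "u s \<le> m" for s
    by (simp add: m_def)
  let ?W = "\<lambda>h s. - (total_reward r h + u s)"
  have "?E (\<lambda>h s. - (total_reward r h + m)) \<le> ?E ?W"
    by (rule history_expectation_mono) (simp add: m)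
  also have "\<dots> \<le> mean \<mu> (?W []) + real n * (- c)"
  proof (rule history_expectation_drift_le)
    fix h s
    show "mean (return_pmf (d s)) (\<lambda>a. mean (p s a) (?W (h @ [(s, a)]))) \<le> ?W h s + - c"
      using assms[of s] by (simp only: mean_return mean_uminus) (simp add: mean_add)
  qed
  finally show "real n * c - (m - mean \<mu> u) \<le> ?E (\<lambda>h s. total_reward r h)"
    unfolding history_expectation_uminus mean_uminus
    by (simp add: history_expectation_add)
qed

section \<open>Policies that search for a satisfactory decision rule\<close>

lemma exp_le_quadratic:
  fixes x :: real
  assumes "\<bar>x\<bar> \<le> 1"
  shows "exp x \<le> 1 + x + x\<^sup>2"
proof (cases "0 \<le> x")
  case True
  then show ?thesis
    using assms by (intro exp_bound) auto
next
  case False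
  have "exp x * (1 - x) \<le> exp x * exp (- x)"
    using exp_ge_add_one_self[of "- x"] by (intro mult_left_mono) auto
  also have "\<dots> = 1"
    by (simp flip: exp_add)
  also have "1 \<le> (1 + x + x\<^sup>2) * (1 - x)"
  proof -
    have "x ^ 3 \<le> 0"
      using False by (simp add: power_le_zero_eq_numeral)
    moreover have "(1 + x + x\<^sup>2) * (1 - x) = 1 - x ^ 3"
      by (simp add: algebra_simps power2_eq_square power3_eq_cube)
    ultimately show ?thesis
      by simp
  qed
  finally show ?thesis
    using False by (simp add: mult_le_cancel_right)
qed

text \<open>
  A bounded increment with positive mean has a negative exponential moment at most \<open>1\<close>, with a
  rate that depends only on the bound and on the mean.
\<close>

lemma exponential_moment_le_1:
  fixes L \<delta> :: real
  assumes "0 < L" "0 < \<delta>"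
  obtains \<theta> where "0 < \<theta>"
    "\<And>(q :: 's::finite pmf) x. (\<And>y. \<bar>x y\<bar> \<le> L) \<Longrightarrow> \<delta> \<le> mean q x \<Longrightarrow> mean q (\<lambda>y. exp (- \<theta> * x y)) \<le> 1"
proof
  define \<theta> where "\<theta> = min (1 / L) (\<delta> / L\<^sup>2)"
  show "0 < \<theta>"
    using assms by (simp add: \<theta>_def)
  have l: "\<theta> * L \<le> 1" "\<theta> * L\<^sup>2 \<le> \<delta>"
    using assms by (auto simp: \<theta>_def min_def field_simps)
  fix q :: "'s pmf" and x :: "'s \<Rightarrow> real"
  assume x: "\<And>y. \<bar>x y\<bar> \<le> L" and m: "\<delta> \<le> mean q x"
  have "exp (- \<theta> * x y) \<le> 1 + \<theta> * \<delta> + (- \<theta>) * x y" for y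
  proof -
    have "\<bar>- \<theta> * x y\<bar> \<le> \<theta> * L"
      using x[of y] \<open>0 < \<theta>\<close> by (simp add: abs_mult)
    then have "exp (- \<theta> * x y) \<le> 1 + (- \<theta> * x y) + (- \<theta> * x y)\<^sup>2"
      using l by (intro exp_le_quadratic) simp
    also have "(- \<theta> * x y)\<^sup>2 = \<theta> * (\<theta> * \<bar>x y\<bar>\<^sup>2)"
      by (simp add: power2_eq_square)
    also have "\<dots> \<le> \<theta> * (\<theta> * L\<^sup>2)"
      using x[of y] \<open>0 < \<theta>\<close> by (intro mult_left_mono power_mono) auto
    also have "\<dots> \<le> \<theta> * \<delta>"
      using l \<open>0 < \<theta>\<close> by (intro mult_left_mono) auto
    finally show ?thesis
      by simp
  qed
  then have "mean q (\<lambda>y. exp (- \<theta> * x y)) \<le> mean q (\<lambda>y. 1 + \<theta> * \<delta> + (- \<theta>) * x y)"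
    by (rule mean_mono)
  also have "\<dots> = 1 + \<theta> * \<delta> - \<theta> * mean q x"
    unfolding mean_add[of q "\<lambda>_. 1 + \<theta> * \<delta>"] mean_cmult by simp
  also have "\<dots> \<le> 1"
    using m \<open>0 < \<theta>\<close> by simp
  finally show "mean q (\<lambda>y. exp (- \<theta> * x y)) \<le> 1" .
qed

text \<open>
  The gaps between consecutive tolerances grow, so later attempts get a larger budget; the growth
  is polynomial, so that it is outweighed by exponentially small failure probabilities.
\<close>

definition tolerance :: "nat \<Rightarrow> real" where
  "tolerance j = (real j + 1)\<^sup>2"

text \<open>
  The policy tries the decision rules \<open>e 0, e 1, \<dots>\<close> in turn. A state \<open>(j, z)\<close> of the search
  consists of the number \<open>j\<close> of the current attempt and the surplus \<open>z\<close> of the collected reward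
  over the target \<open>c\<close> per step. The surplus is counted from time \<open>0\<close> and not from the start of the
  attempt, so that the current tolerance alone bounds the total regret.
\<close>

fun search_step :: "('s \<Rightarrow> 'a \<Rightarrow> real) \<Rightarrow> real \<Rightarrow> nat \<times> real \<Rightarrow> 's \<times> 'a \<Rightarrow> nat \<times> real" where
  "search_step r c (j, z) (s, a) =
     (let z' = z + r s a - c in (if z' < - tolerance j then Suc j else j, z'))"

definition search_state :: "('s \<Rightarrow> 'a \<Rightarrow> real) \<Rightarrow> real \<Rightarrow> ('s \<times> 'a) list \<Rightarrow> nat \<times> real" where
  "search_state r c h = foldl (search_step r c) (0, 0) h"

definition satisficing_policy ::
    "('s \<Rightarrow> 'a \<Rightarrow> real) \<Rightarrow> real \<Rightarrow> (nat \<Rightarrow> 's \<Rightarrow> 'a) \<Rightarrow> ('s, 'a) policy" where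
  "satisficing_policy r c e h s = return_pmf (e (fst (search_state r c h)) s)"

lemma tolerance_mono: "i \<le> j \<Longrightarrow> tolerance i \<le> tolerance j"
  by (simp add: tolerance_def power_mono)

lemma search_state_Nil [simp]: "search_state r c [] = (0, 0)"
  by (simp add: search_state_def)

lemma search_state_snoc [simp]:
  "search_state r c (h @ [(s, a)]) = search_step r c (search_state r c h) (s, a)"
  by (simp add: search_state_def)

lemma search_state_surplus: "snd (search_state r c h) = total_reward r h - real (length h) * c"
proof (induction h rule: rev_induct)
  case (snoc x h)
  then show ?case
    by (cases x; cases "search_state r c h") (simp add: Let_def algebra_simps)
qed simp

text \<open>
  One step lowers the surplus by at most \<open>1\<close>, and consecutive tolerances differ by at least \<open>1\<close>.
  So the surplus is at least \<open>- tolerance j\<close> even right after switching to attempt \<open>j\<close>, and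
  bounding the regret amounts to bounding the expected tolerance.
\<close>

lemma search_state_tolerance:
  assumes "\<And>s a. 0 \<le> r s a" "c \<le> 1"
  shows "- tolerance (fst (search_state r c h)) \<le> snd (search_state r c h)"
proof (induction h rule: rev_induct)
  case Nil
  then show ?case
    by (simp add: tolerance_def)
next
  case (snoc x h)
  obtain s a where x: "x = (s, a)"
    by (cases x)
  obtain j z where jz: "search_state r c h = (j, z)"
    by (cases "search_state r c h")
  have "tolerance j + 1 \<le> tolerance (Suc j)"
    by (simp add: tolerance_def power2_eq_square algebra_simps)
  then show ?case
    using snoc assms(1)[of s a] assms(2) by (simp add: x jz Let_def)
qed

text \<open>
  Under the good rule \<open>d\<close> the surplus plus \<open>u\<close> has drift at least \<open>\<delta>\<close>, so \<open>exp (- \<theta> * _)\<close> of it is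
  a supermartingale: an attempt with \<open>d\<close> and budget \<open>b\<close> fails with probability at most a constant
  times \<open>exp (- \<theta> * b)\<close>. This is turned into a potential \<open>V\<close> on search states that dominates the
  tolerance and does not increase in expectation. During a bad attempt \<open>V\<close> is the constant \<open>U j\<close>,
  which pays for the next good attempt; during a good attempt it is the current tolerance plus the
  price of failure weighted by the exponential. Good attempts recur within \<open>m\<close> steps, so \<open>U\<close>
  grows polynomially, and from some attempt \<open>j0\<close> on the weighted price of failure is at most
  \<open>1\<close> when the attempt starts. Before \<open>j0\<close> the potential is constant.
\<close>

lemma satisficing_policy_regret_bounded:
  fixes r :: "'s::finite \<Rightarrow> 'a::finite \<Rightarrow> real"
  assumes r: "\<And>s a. r s a \<in> {0..1}" and c: "c \<le> 1"
    and recurrent: "\<And>j. \<exists>i\<ge>j. i \<le> j + m \<and> e i = d"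
    and \<delta>: "0 < \<delta>" and drift: "\<And>s. u s + (c + \<delta>) \<le> r s (d s) + mean (p s (d s)) u"
  obtains K where "\<And>n. real n * c - K
    \<le> history_expectation \<mu> (satisficing_policy r c e) (\<lambda>h s a. p s a) n (\<lambda>h s. total_reward r h)"
proof -
  define B where "B = Max (range (\<lambda>s. \<bar>u s\<bar>))"
  have B: "\<bar>u s\<bar> \<le> B" for s
    by (simp add: B_def)
  define L where "L = 1 + \<bar>c\<bar> + 2 * B"
  have "0 < L"
    using B[of undefined] by (simp add: L_def)
  then obtain \<theta> where \<theta>: "0 < \<theta>"
    and moment: "\<And>(q :: 's pmf) x. (\<And>y. \<bar>x y\<bar> \<le> L) \<Longrightarrow> \<delta> \<le> mean q x \<Longrightarrow>
      mean q (\<lambda>y. exp (- \<theta> * x y)) \<le> 1"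
    using exponential_moment_le_1[OF _ \<delta>] by blast

  \<comment> \<open>The first factor bounds \<open>U (Suc j)\<close>; \<open>2 * j - 2 * B\<close> bounds the budget of attempt \<open>j\<close>, corrected by \<open>u\<close>, from below.\<close>
  have "((\<lambda>j::nat. ((real j + 1 + real m + 1)\<^sup>2 + 1) * exp (- \<theta> * (2 * real j - 2 * B))) \<longlongrightarrow> 0) at_top"
    using \<theta> by real_asymp
  then have "\<forall>\<^sub>F j in at_top. ((real j + 1 + real m + 1)\<^sup>2 + 1) * exp (- \<theta> * (2 * real j - 2 * B)) < 1"
    by (rule order_tendstoD) simp
  then obtain j1 where j1: "\<And>j. j1 \<le> j \<Longrightarrow>
      ((real j + 1 + real m + 1)\<^sup>2 + 1) * exp (- \<theta> * (2 * real j - 2 * B)) < 1"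
    unfolding eventually_at_top_linorder by blast
  define j0 where "j0 = Suc j1"

  define next_good where "next_good j = (LEAST i. j \<le> i \<and> e i = d)" for j
  have next_good: "j \<le> next_good j" "next_good j \<le> j + m" for j
  proof -
    obtain i where i: "j \<le> i" "i \<le> j + m" "e i = d"
      using recurrent by blast
    then have "j \<le> next_good j \<and> e (next_good j) = d"
      unfolding next_good_def by (intro LeastI[of "\<lambda>i. j \<le> i \<and> e i = d" i]) auto
    moreover have "next_good j \<le> i"
      unfolding next_good_def using i by (intro Least_le) auto
    ultimately show "j \<le> next_good j" "next_good j \<le> j + m"
      using i by auto
  qed
  have next_good_bad: "next_good (Suc j) = next_good j" if "e j \<noteq> d" for j
  proof -
    have "(Suc j \<le> i \<and> e i = d) = (j \<le> i \<and> e i = d)" for i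
      using that by (metis Suc_leD Suc_leI le_neq_implies_less)
    then show ?thesis
      by (simp add: next_good_def)
  qed
  have next_good_good: "next_good j = j" if "e j = d" for j
    unfolding next_good_def using that by (intro Least_equality) auto

  define U where "U j = tolerance (next_good j) + 1" for j
  have U_ge: "tolerance j + 1 \<le> U j" for j
    using next_good(1)[of j] by (simp add: U_def tolerance_mono)
  have tol_nonneg: "0 \<le> tolerance j" for j
    by (simp add: tolerance_def)
  have U_nonneg: "0 \<le> U j" for j
    using U_ge[of j] tol_nonneg[of j] by simp
  define V where "V j z s =
      (if j < j0 then U j0
       else if e j \<noteq> d then U j
       else tolerance j + U (Suc j) * exp (- \<theta> * (z + tolerance j + u s - B)))" for j z s

  \<comment> \<open>The lower bound on \<open>z\<close> is what is left when attempt \<open>j - 1\<close> has just failed.\<close>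
  have V_start: "V j z s \<le> U j" if j: "j0 \<le> j" and z: "- (real j)\<^sup>2 - 1 \<le> z" for j z s
  proof (cases "e j = d")
    case True
    have "U (Suc j) \<le> (real j + 1 + real m + 1)\<^sup>2 + 1"
      using tolerance_mono[OF next_good(2)[of "Suc j"]]
      by (simp add: U_def tolerance_def algebra_simps)
    moreover have "2 * real j - 2 * B \<le> z + tolerance j + u s - B"
      using z B[of s] by (simp add: tolerance_def power2_eq_square algebra_simps abs_le_iff)
    then have "exp (- \<theta> * (z + tolerance j + u s - B)) \<le> exp (- \<theta> * (2 * real j - 2 * B))"
      using \<theta> by simp
    ultimately have "U (Suc j) * exp (- \<theta> * (z + tolerance j + u s - B))
        \<le> ((real j + 1 + real m + 1)\<^sup>2 + 1) * exp (- \<theta> * (2 * real j - 2 * B))"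
      by (intro mult_mono) auto
    also have "\<dots> \<le> 1"
      using j1[of j] j by (simp add: j0_def)
    finally show ?thesis
      using True j by (simp add: V_def U_def next_good_good)
  qed (use j in \<open>simp add: V_def\<close>)
  have V_ge: "tolerance j \<le> V j z s" for j z s
    using tolerance_mono[of j j0] U_ge[of j0] U_ge[of j] U_nonneg[of "Suc j"]
    by (auto simp: V_def)

  let ?\<pi> = "satisficing_policy r c e"
  let ?E = "history_expectation \<mu> ?\<pi> (\<lambda>h s a. p s a)"
  define W where "W h s = V (fst (search_state r c h)) (snd (search_state r c h)) s" for h s
  have step: "mean (?\<pi> h s) (\<lambda>a. mean (p s a) (W (h @ [(s, a)]))) \<le> W h s + 0" for h s
  proof -
    obtain j z where jz: "search_state r c h = (j, z)"
      by (cases "search_state r c h")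
    define a where "a = e j s"
    define z' where "z' = z + r s a - c"
    define j' where "j' = (if z' < - tolerance j then Suc j else j)"
    have z_ge: "- tolerance j \<le> z"
      using search_state_tolerance[of r c h] r c by (simp add: jz)
    have z'_ge: "- (real (Suc j))\<^sup>2 - 1 \<le> z'"
      using z_ge r[of s a] c by (simp add: z'_def tolerance_def add.commute)
    have "mean (p s a) (V j' z') \<le> V j z s"
    proof (cases "j0 \<le> j \<and> e j = d")
      case False
      have "V j' z' s' \<le> V j z s" for s'
      proof (cases "j < j0")
        case True
        then show ?thesis
          using V_start[OF _ z'_ge, of s'] by (cases "Suc j = j0") (auto simp: j'_def V_def)
      next
        case False
        with \<open>\<not> (j0 \<le> j \<and> e j = d)\<close> have "j0 \<le> j" "e j \<noteq> d"
          by auto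
        then have "V j z s = U j" "V j z' s' = U j" "U (Suc j) = U j"
          by (auto simp: V_def U_def next_good_bad)
        then show ?thesis
          using V_start[OF _ z'_ge, of s'] \<open>j0 \<le> j\<close> by (auto simp: j'_def)
      qed
      then have "mean (p s a) (V j' z') \<le> mean (p s a) (\<lambda>_. V j z s)"
        by (rule mean_mono)
      then show ?thesis
        by simp
    next
      case True
      define y where "y = exp (- \<theta> * (z + tolerance j + u s - B))"
      define x where "x s' = r s a - c + u s' - u s" for s'
      have V_eq: "V j z s = tolerance j + U (Suc j) * y"
        using True by (simp add: V_def y_def)
      have exp_eq: "exp (- \<theta> * (z' + tolerance j + u s' - B)) = y * exp (- \<theta> * x s')" for s'
        by (simp add: y_def x_def z'_def algebra_simps flip: exp_add)
      have "V j' z' s' \<le> tolerance j + U (Suc j) * y * exp (- \<theta> * x s')" for s'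
      proof (cases "z' < - tolerance j")
        case fail: True
        \<comment> \<open>On failure the exponential weight is at least \<open>1\<close>, so it pays the full price \<open>U (Suc j)\<close>.\<close>
        have "0 \<le> - \<theta> * (z' + tolerance j + u s' - B)"
          using fail B[of s'] \<theta> by (intro mult_nonpos_nonpos) auto
        then have "1 \<le> y * exp (- \<theta> * x s')"
          unfolding exp_eq[symmetric] by simp
        then have "U (Suc j) * 1 \<le> U (Suc j) * (y * exp (- \<theta> * x s'))"
          using U_nonneg by (intro mult_left_mono)
        moreover have "V (Suc j) z' s' \<le> U (Suc j)"
          using V_start[OF _ z'_ge] True by simp
        ultimately show ?thesis
          using fail tol_nonneg[of j] by (simp add: j'_def mult.assoc)
      next
        case False
        with True have "V j' z' s'
            = tolerance j + U (Suc j) * exp (- \<theta> * (z' + tolerance j + u s' - B))"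
          by (simp add: j'_def V_def)
        then show ?thesis
          unfolding exp_eq by (simp add: mult.assoc)
      qed
      then have "mean (p s a) (V j' z')
          \<le> mean (p s a) (\<lambda>s'. tolerance j + U (Suc j) * y * exp (- \<theta> * x s'))"
        by (rule mean_mono)
      also have "\<dots> = tolerance j + U (Suc j) * y * mean (p s a) (\<lambda>s'. exp (- \<theta> * x s'))"
        by (simp add: mean_add mean_cmult)
      also have "mean (p s a) (\<lambda>s'. exp (- \<theta> * x s')) \<le> 1"
      proof (rule moment)
        show "\<bar>x s'\<bar> \<le> L" for s'
          using B[of s] B[of s'] r[of s a] by (auto simp: x_def L_def)
        have "x = (\<lambda>s'. (r s a - c - u s) + u s')"
          by (simp add: x_def fun_eq_iff)
        then have "mean (p s a) x = (r s a - c - u s) + mean (p s a) u"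
          by (simp add: mean_add)
        then show "\<delta> \<le> mean (p s a) x"
          using drift[of s] True by (simp add: a_def)
      qed
      then have "tolerance j + U (Suc j) * y * mean (p s a) (\<lambda>s'. exp (- \<theta> * x s'))
          \<le> tolerance j + U (Suc j) * y * 1"
        using U_nonneg by (intro add_left_mono mult_left_mono) (auto simp: y_def)
      finally show ?thesis
        by (simp add: V_eq)
    qed
    moreover have "W (h @ [(s, a)]) = V j' z'"
      by (simp add: W_def fun_eq_iff jz Let_def z'_def j'_def)
    moreover have "?\<pi> h s = return_pmf a" "W h s = V j z s"
      by (simp_all add: satisficing_policy_def W_def jz a_def)
    ultimately show ?thesis
      by simp
  qed
  have W_Nil: "W [] s = U j0" for s
    by (simp add: W_def V_def j0_def)

  have "real n * c - U j0 \<le> ?E n (\<lambda>h s. total_reward r h)" for n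
  proof -
    have "?E n (\<lambda>h s. - (total_reward r h + - (real n * c))) \<le> ?E n W"
    proof (rule history_expectation_mono)
      fix h :: "('s \<times> 'a) list" and s assume "length h = n"
      then have "- (total_reward r h + - (real n * c)) = - snd (search_state r c h)"
        by (simp add: search_state_surplus)
      also have "\<dots> \<le> tolerance (fst (search_state r c h))"
        using search_state_tolerance[of r c h] r c by simp
      also have "\<dots> \<le> W h s"
        unfolding W_def by (rule V_ge)
      finally show "- (total_reward r h + - (real n * c)) \<le> W h s" .
    qed
    also have "\<dots> \<le> mean \<mu> (W []) + real n * 0"
      by (rule history_expectation_drift_le) (rule step)
    also have "mean \<mu> (W []) + real n * 0 = U j0"
      using mean_const[of \<mu> "U j0"] unfolding W_Nil[abs_def, symmetric] by simp
    finally show ?thesis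
      unfolding history_expectation_uminus history_expectation_add by simp
  qed
  then show ?thesis
    by (rule that)
qed

section \<open>Optimal gains against a stationary adversary\<close>

lemma finite_type_recurrent_enumeration:
  obtains e :: "nat \<Rightarrow> 'b::finite" and m where "\<And>j x. \<exists>i\<ge>j. i \<le> j + m \<and> e i = x"
proof -
  define m where "m = CARD('b)"
  obtain f :: "nat \<Rightarrow> 'b" where f: "bij_betw f {0..<m} UNIV"
    using ex_bij_betw_nat_finite[of "UNIV :: 'b set"] by (auto simp: m_def)
  have "m > 0"
    by (simp add: m_def)
  have "\<exists>i\<ge>j. i \<le> j + m \<and> f (i mod m) = x" for j x
  proof -
    obtain k where k: "k < m" "f k = x"
      using f by (auto simp: bij_betw_def image_iff set_eq_iff) (metis atLeastLessThan_iff rangeI)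
    define i where "i = j + (k + m - j mod m) mod m"
    have "j mod m < m"
      using \<open>m > 0\<close> by simp
    then have "j + (k + m - j mod m) = k + (j div m + 1) * m"
      using div_mult_mod_eq[of j m] unfolding add_mult_distrib mult_1 by arith
    then have "i mod m = k"
      using k by (simp only: i_def mod_add_right_eq mod_mult_self1 mod_less)
    moreover have "j \<le> i" "i \<le> j + m"
      using \<open>m > 0\<close> by (simp_all add: i_def less_imp_le)
    ultimately show ?thesis
      using k by blast
  qed
  then show ?thesis
    by (rule that[where e = "\<lambda>i. f (i mod m)"])
qed

lemma lower_gain_le_1:
  fixes r :: "'s::finite \<Rightarrow> 'a::finite \<Rightarrow> real"
  assumes r: "\<And>s a. r s a \<in> {0..1}"
  shows "lower_gain r \<mu> \<pi> (\<lambda>h s a. p s a) \<le> 1"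
proof -
  have "upper_gain r \<mu> \<pi> (\<lambda>h s a. p s a) \<le> ereal 1"
    by (rule upper_gain_le_of_superharmonic[where u = "\<lambda>_. 0"]) (use r in auto)
  with lower_gain_le_upper_gain show ?thesis
    unfolding one_ereal_def by (rule order_trans)
qed

lemma deterministic_stationary:
  assumes Q: "range return_pmf \<subseteq> Q"
  shows "(\<lambda>h s. return_pmf (d s)) \<in> stationary_policies Q"
  using Q by (auto simp: stationary_policies_def decision_rules_def
      intro!: exI[of _ "\<lambda>s. return_pmf (d s)"])

lemma stationary_subset_history: "stationary_policies Q \<subseteq> history_policies Q"
  by (auto simp: stationary_policies_def decision_rules_def history_policies_def)

lemma satisficing_policy_in_history_policies:
  assumes Q: "range return_pmf \<subseteq> Q"
  shows "satisficing_policy r c e \<in> history_policies Q"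
  using Q by (auto simp: history_policies_def satisficing_policy_def)

text \<open>
  The reverse inequality is trivial. Hence against a fixed kernel, neither the choice of upper or
  lower gain nor the use of history-dependent policies affects the optimal value.
\<close>

lemma optimal_upper_le_stationary_lower:
  fixes r :: "'s::finite \<Rightarrow> 'a::finite \<Rightarrow> real"
  assumes r: "\<And>s a. r s a \<in> {0..1}" and Q: "range return_pmf \<subseteq> Q"
    and wc: "weakly_communicating Q p"
  shows "(SUP \<pi>\<in>history_policies Q. upper_gain r \<mu> \<pi> (\<lambda>h s a. p s a))
    \<le> (SUP \<pi>\<in>stationary_policies Q. lower_gain r \<mu> \<pi> (\<lambda>h s a. p s a))" (is "?U \<le> ?L")
proof (rule ereal_le_epsilon2)
  fix \<epsilon> :: real assume "0 < \<epsilon>"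
  then have "0 < \<epsilon> / 2"
    by simp
  then obtain \<alpha> u d where
    super: "\<And>s a. r s a + mean (p s a) u \<le> u s + (\<alpha> + \<epsilon> / 2)" and
    sub: "\<And>s. u s + (\<alpha> - \<epsilon> / 2) \<le> r s (d s) + mean (p s (d s)) u"
    by (rule approximate_average_optimality[where r = r, OF r Q wc]) (rule that)
  have "?U \<le> ereal (\<alpha> + \<epsilon> / 2)"
    by (rule SUP_least) (rule upper_gain_le_of_superharmonic[OF super])
  also have "\<dots> = ereal (\<alpha> - \<epsilon> / 2) + ereal \<epsilon>"
    by simp
  also have "ereal (\<alpha> - \<epsilon> / 2) \<le> ?L"
    by (rule order_trans[OF _ SUP_upper[OF deterministic_stationary[OF Q]]])
      (rule lower_gain_ge_of_subharmonic[where r = r and d = d and p = p and u = u, OF sub])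
  finally show "?U \<le> ?L + ereal \<epsilon>"
    by (simp add: add_right_mono)
qed

text \<open>
  The enumeration \<open>e\<close> of the deterministic decision rules is independent of the kernel \<open>p\<close>, so a
  single policy reaches the target \<open>c\<close> against every kernel whose optimal gain exceeds \<open>c\<close>.
\<close>

lemma satisficing_policy_universal:
  fixes r :: "'s::finite \<Rightarrow> 'a::finite \<Rightarrow> real"
  assumes r: "\<And>s a. r s a \<in> {0..1}" and Q: "range return_pmf \<subseteq> Q"
  obtains e where
    "\<And>c p \<mu>. c \<le> 1 \<Longrightarrow> weakly_communicating Q p \<Longrightarrow>
      ereal c < (SUP \<pi>\<in>stationary_policies Q. lower_gain r \<mu> \<pi> (\<lambda>h s a. p s a)) \<Longrightarrow>
      ereal c \<le> lower_gain r \<mu> (satisficing_policy r c e) (\<lambda>h s a. p s a)"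
proof -
  obtain e :: "nat \<Rightarrow> 's \<Rightarrow> 'a" and m
    where e: "\<And>j d. \<exists>i\<ge>j. i \<le> j + m \<and> e i = d"
    by (rule finite_type_recurrent_enumeration) blast
  show ?thesis
  proof (rule that[of e])
    fix c p \<mu>
    assume c: "c \<le> 1" and wc: "weakly_communicating Q p"
      and less: "ereal c < (SUP \<pi>\<in>stationary_policies Q. lower_gain r \<mu> \<pi> (\<lambda>h s a. p s a))"
    then obtain \<pi> where \<pi>: "ereal c < lower_gain r \<mu> \<pi> (\<lambda>h s a. p s a)"
      unfolding less_SUP_iff by blast
    then obtain c' where c': "c < c'" "ereal c' < lower_gain r \<mu> \<pi> (\<lambda>h s a. p s a)"
      using ereal_dense2 by force
    define \<delta> where "\<delta> = (c' - c) / 3"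
    have "0 < \<delta>"
      using c' by (simp add: \<delta>_def)
    then obtain \<alpha> u d where
      super: "\<And>s a. r s a + mean (p s a) u \<le> u s + (\<alpha> + \<delta>)" and
      sub: "\<And>s. u s + (\<alpha> - \<delta>) \<le> r s (d s) + mean (p s (d s)) u"
      by (rule approximate_average_optimality[where r = r, OF r Q wc]) (rule that)
    have "ereal c' < upper_gain r \<mu> \<pi> (\<lambda>h s a. p s a)"
      using c'(2) lower_gain_le_upper_gain by (rule less_le_trans)
    also have "\<dots> \<le> ereal (\<alpha> + \<delta>)"
      by (rule upper_gain_le_of_superharmonic[OF super])
    finally have "c' < \<alpha> + \<delta>"
      by simp
    moreover have "3 * \<delta> = c' - c"
      by (simp add: \<delta>_def)
    ultimately have "c + \<delta> \<le> \<alpha> - \<delta>"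
      by linarith
    then have drift: "u s + (c + \<delta>) \<le> r s (d s) + mean (p s (d s)) u" for s
      using sub[of s] by simp
    obtain K where "\<And>n. real n * c - K \<le> history_expectation \<mu> (satisficing_policy r c e)
        (\<lambda>h s a. p s a) n (\<lambda>h s. total_reward r h)"
      by (rule satisficing_policy_regret_bounded[where \<mu> = \<mu> and r = r and d = d and p = p and u = u, OF r c e \<open>0 < \<delta>\<close> drift]) (rule that)
    then show "ereal c \<le> lower_gain r \<mu> (satisficing_policy r c e) (\<lambda>h s a. p s a)"
      by (rule lower_gain_geI)
  qed
qed

section \<open>Solutions of the inf-sup equation\<close>

lemma inf_sup_step_eq:
  fixes r :: "'s::finite \<Rightarrow> 'a::finite \<Rightarrow> real"
  shows "(\<Sum>a\<in>UNIV. \<Sum>s'\<in>UNIV. pmf \<phi> a * pmf (ps a) s' * (r s a - \<alpha> + u s'))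
    = mean \<phi> (\<lambda>a. r s a - \<alpha> + mean (ps a) u)"
proof -
  have "(\<Sum>s'\<in>UNIV. pmf \<phi> a * pmf (ps a) s' * (r s a - \<alpha> + u s'))
      = pmf \<phi> a * (r s a - \<alpha> + mean (ps a) u)" for a
  proof -
    have "(\<Sum>s'\<in>UNIV. pmf \<phi> a * pmf (ps a) s' * (r s a - \<alpha> + u s'))
        = pmf \<phi> a * mean (ps a) (\<lambda>s'. r s a - \<alpha> + u s')"
      by (simp add: mean_def sum_distrib_left mult.assoc)
    then show ?thesis
      by (simp add: mean_add)
  qed
  then show ?thesis
    by (simp add: mean_def[of \<phi>])
qed

text \<open>
  The supremum over randomized actions is a supremum of averages, so it is dominated by the best
  single action.
\<close>

lemma inf_sup_solution_subharmonic:
  fixes r :: "'s::finite \<Rightarrow> 'a::finite \<Rightarrow> real"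
  assumes sol: "inf_sup_solution r Q P u \<alpha>" and p: "p \<in> kernels P"
  obtains d where "\<And>s. u s + \<alpha> \<le> r s (d s) + mean (p s (d s)) u"
proof -
  have "\<exists>a. u s + \<alpha> \<le> r s a + mean (p s a) u" for s
  proof -
    define M where "M = Max (range (\<lambda>a. r s a - \<alpha> + mean (p s a) u))"
    have "M \<in> range (\<lambda>a. r s a - \<alpha> + mean (p s a) u)"
      unfolding M_def by (rule Max_in) auto
    then obtain a where a: "M = r s a - \<alpha> + mean (p s a) u"
      by blast
    have "ereal (u s) \<le> (SUP \<phi>\<in>Q. ereal (mean \<phi> (\<lambda>a. r s a - \<alpha> + mean (p s a) u)))"
      using sol p unfolding inf_sup_solution_def inf_sup_step_eq kernels_def
      by (auto intro: INF_lower)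
    also have "\<dots> \<le> ereal M"
    proof (intro SUP_least)
      fix \<phi>
      have "mean \<phi> (\<lambda>a. r s a - \<alpha> + mean (p s a) u) \<le> mean \<phi> (\<lambda>_. M)"
        by (rule mean_mono) (simp add: M_def)
      then show "ereal (mean \<phi> (\<lambda>a. r s a - \<alpha> + mean (p s a) u)) \<le> ereal M"
        by simp
    qed
    finally show ?thesis
      using a by (intro exI[of _ a]) simp
  qed
  then show ?thesis
    using that by metis
qed

text \<open>
  In each state the infimum is attained up to \<open>\<epsilon>\<close>, and the adversary may combine these choices
  freely; against the combined kernel no action gains more than \<open>\<alpha> + \<epsilon>\<close>.
\<close>

lemma inf_sup_solution_superharmonic:
  fixes r :: "'s::finite \<Rightarrow> 'a::finite \<Rightarrow> real"
  assumes sol: "inf_sup_solution r Q P u \<alpha>" and Q: "range return_pmf \<subseteq> Q" and e: "0 < \<epsilon>"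
  obtains p where "p \<in> kernels P" "\<And>s a. r s a + mean (p s a) u \<le> u s + (\<alpha> + \<epsilon>)"
proof -
  have "\<exists>ps\<in>P s. \<forall>a. r s a + mean (ps a) u \<le> u s + (\<alpha> + \<epsilon>)" for s
  proof -
    have "(INF ps\<in>P s. SUP \<phi>\<in>Q. ereal (mean \<phi> (\<lambda>a. r s a - \<alpha> + mean (ps a) u))) = ereal (u s)"
      using sol unfolding inf_sup_solution_def inf_sup_step_eq by simp
    also have "\<dots> < ereal (u s + \<epsilon>)"
      using e by simp
    finally obtain ps where ps: "ps \<in> P s"
      and less: "(SUP \<phi>\<in>Q. ereal (mean \<phi> (\<lambda>a. r s a - \<alpha> + mean (ps a) u))) < ereal (u s + \<epsilon>)"
      unfolding INF_less_iff by blast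
    have "r s a + mean (ps a) u \<le> u s + (\<alpha> + \<epsilon>)" for a
    proof -
      have "return_pmf a \<in> Q"
        using Q by blast
      then have "ereal (mean (return_pmf a) (\<lambda>a. r s a - \<alpha> + mean (ps a) u)) < ereal (u s + \<epsilon>)"
        by (rule le_less_trans[OF SUP_upper less])
      then show ?thesis
        by simp
    qed
    with ps show ?thesis
      by blast
  qed
  then obtain p where "\<And>s. p s \<in> P s" "\<And>s a. r s a + mean (p s a) u \<le> u s + (\<alpha> + \<epsilon>)"
    by metis
  then show ?thesis
    by (intro that[of p]) (auto simp: kernels_def)
qed

section \<open>Minimax equality\<close>

lemma SUP_INF_le_INF_SUP:
  fixes f :: "'b \<Rightarrow> 'c \<Rightarrow> 'd::complete_lattice"
  shows "(SUP x\<in>A. INF y\<in>B. f x y) \<le> (INF y\<in>B. SUP x\<in>A. f x y)"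
  by (intro SUP_least INF_greatest) (auto intro: INF_lower2 SUP_upper2)

text \<open>
  The common value is the infimum \<open>G\<close> over the kernels of the optimal stationary lower gain. Weak
  duality and monotonicity bound every other quantity by \<open>G\<close> from above, and the satisficing
  policies with targets below \<open>G\<close> give the bounds from below.
\<close>

theorem theorem8:
  fixes r :: "'s::finite \<Rightarrow> 'a::finite \<Rightarrow> real"
    and Q :: "'a pmf set"
    and P :: "'s \<Rightarrow> ('a \<Rightarrow> 's pmf) set"
    and \<mu> :: "'s pmf"
  assumes "\<And>s a. r s a \<in> {0..1}"
    and "\<And>s. P s \<noteq> {}"
    and "range return_pmf \<subseteq> Q"
    and "weakly_communicating_adversary Q P"
  shows
    "(lower_value r \<mu> (history_policies Q) (stationary_adversaries P) =
        (INF \<kappa>\<in>stationary_adversaries P. SUP \<pi>\<in>history_policies Q. lower_gain r \<mu> \<pi> \<kappa>) \<and>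
      (INF \<kappa>\<in>stationary_adversaries P. SUP \<pi>\<in>history_policies Q. lower_gain r \<mu> \<pi> \<kappa>) =
        (INF \<kappa>\<in>stationary_adversaries P. SUP \<pi>\<in>stationary_policies Q. lower_gain r \<mu> \<pi> \<kappa>)) \<and>
     (upper_value r \<mu> (history_policies Q) (stationary_adversaries P) =
        (INF \<kappa>\<in>stationary_adversaries P. SUP \<pi>\<in>history_policies Q. upper_gain r \<mu> \<pi> \<kappa>) \<and>
      (INF \<kappa>\<in>stationary_adversaries P. SUP \<pi>\<in>history_policies Q. upper_gain r \<mu> \<pi> \<kappa>) =
        (INF \<kappa>\<in>stationary_adversaries P. SUP \<pi>\<in>stationary_policies Q. upper_gain r \<mu> \<pi> \<kappa>)) \<and>
     (\<forall>u' \<alpha>'. \<alpha>' \<in> {0..1} \<and> inf_sup_solution r Q P u' \<alpha>' \<longrightarrow>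
        lower_value r \<mu> (history_policies Q) (stationary_adversaries P) = ereal \<alpha>' \<and>
        upper_value r \<mu> (history_policies Q) (stationary_adversaries P) = ereal \<alpha>')"
proof -
  note r = assms(1) and Q = assms(3)
  let ?K = "stationary_adversaries P" and ?H = "history_policies Q" and ?S = "stationary_policies Q"
  define G where "G = (INF \<kappa>\<in>?K. SUP \<pi>\<in>?S. lower_gain r \<mu> \<pi> \<kappa>)"
  have wc: "weakly_communicating Q p" if "p \<in> kernels P" for p
    using assms(4) that by (auto simp: weakly_communicating_adversary_def)
  have adv: "\<exists>p\<in>kernels P. \<kappa> = (\<lambda>h s a. p s a)" if "\<kappa> \<in> ?K" for \<kappa>
    using that by (simp add: stationary_adversaries_def)
  have stationary: "(\<lambda>h s a. p s a) \<in> ?K" if "p \<in> kernels P" for p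
    using that by (auto simp: stationary_adversaries_def)
  have p0: "(\<lambda>s. SOME ps. ps \<in> P s) \<in> kernels P"
    using assms(2) by (simp add: kernels_def some_in_eq)
  have upper_stationary: "(SUP \<pi>\<in>?H. upper_gain r \<mu> \<pi> \<kappa>) \<le> (SUP \<pi>\<in>?S. lower_gain r \<mu> \<pi> \<kappa>)"
    if \<kappa>: "\<kappa> \<in> ?K" for \<kappa>
  proof -
    obtain p where p: "p \<in> kernels P" "\<kappa> = (\<lambda>h s a. p s a)"
      using adv[OF \<kappa>] by blast
    show ?thesis
      unfolding p(2) by (rule optimal_upper_le_stationary_lower[where r = r, OF r Q wc[OF p(1)]])
  qed

  have G_le: "G \<le> lower_value r \<mu> ?H ?K"
  proof (rule dense_le)
    fix x assume "x < G"
    then obtain c where c: "x < ereal c" "ereal c < G"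
      using ereal_dense2 by blast
    have less: "ereal c < (SUP \<pi>\<in>?S. lower_gain r \<mu> \<pi> (\<lambda>h s a. p s a))" if "p \<in> kernels P" for p
      using c(2) INF_lower[OF stationary[OF that]] unfolding G_def by (rule less_le_trans)
    have "ereal c < 1"
      using less[OF p0] by (rule less_le_trans) (intro SUP_least lower_gain_le_1[where r = r] r)
    then have "c \<le> 1"
      by simp
    obtain e where e: "\<And>c p \<mu>. c \<le> 1 \<Longrightarrow> weakly_communicating Q p \<Longrightarrow>
      ereal c < (SUP \<pi>\<in>?S. lower_gain r \<mu> \<pi> (\<lambda>h s a. p s a)) \<Longrightarrow>
      ereal c \<le> lower_gain r \<mu> (satisficing_policy r c e) (\<lambda>h s a. p s a)"
      by (rule satisficing_policy_universal[where r = r, OF r Q]) (rule that)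
    have "ereal c \<le> (INF \<kappa>\<in>?K. lower_gain r \<mu> (satisficing_policy r c e) \<kappa>)"
    proof (rule INF_greatest)
      fix \<kappa> assume "\<kappa> \<in> ?K"
      then obtain p where "p \<in> kernels P" "\<kappa> = (\<lambda>h s a. p s a)"
        using adv by blast
      then show "ereal c \<le> lower_gain r \<mu> (satisficing_policy r c e) \<kappa>"
        using e[OF \<open>c \<le> 1\<close> wc less] by simp
    qed
    also have "\<dots> \<le> lower_value r \<mu> ?H ?K"
      unfolding lower_value_def
      by (rule SUP_upper[OF satisficing_policy_in_history_policies[OF Q]])
    finally show "x \<le> lower_value r \<mu> ?H ?K"
      using c(1) by simp
  qed
  have le_G: "(INF \<kappa>\<in>?K. SUP \<pi>\<in>?H. upper_gain r \<mu> \<pi> \<kappa>) \<le> G"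
    unfolding G_def by (rule INF_mono) (use upper_stationary in blast)
  have lower_weak: "lower_value r \<mu> ?H ?K \<le> (INF \<kappa>\<in>?K. SUP \<pi>\<in>?H. lower_gain r \<mu> \<pi> \<kappa>)"
    unfolding lower_value_def by (rule SUP_INF_le_INF_SUP)
  have upper_weak: "upper_value r \<mu> ?H ?K \<le> (INF \<kappa>\<in>?K. SUP \<pi>\<in>?H. upper_gain r \<mu> \<pi> \<kappa>)"
    unfolding upper_value_def by (rule SUP_INF_le_INF_SUP)
  have lower_upper_value: "lower_value r \<mu> ?H ?K \<le> upper_value r \<mu> ?H ?K"
    unfolding lower_value_def upper_value_def
    by (intro SUP_subset_mono INF_superset_mono lower_gain_le_upper_gain order_refl)
  have lower_upper: "(INF \<kappa>\<in>?K. SUP \<pi>\<in>A. lower_gain r \<mu> \<pi> \<kappa>) \<le> (INF \<kappa>\<in>?K. SUP \<pi>\<in>A. upper_gain r \<mu> \<pi> \<kappa>)"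
    for A
    by (intro SUP_subset_mono INF_superset_mono lower_gain_le_upper_gain order_refl)
  have stationary_history: "(INF \<kappa>\<in>?K. SUP \<pi>\<in>?S. upper_gain r \<mu> \<pi> \<kappa>) \<le> (INF \<kappa>\<in>?K. SUP \<pi>\<in>?H. upper_gain r \<mu> \<pi> \<kappa>)"
    by (intro SUP_subset_mono INF_superset_mono stationary_subset_history order_refl)
  have lower_G: "lower_value r \<mu> ?H ?K = G"
    and upper_G: "upper_value r \<mu> ?H ?K = G"
    and H_lower: "(INF \<kappa>\<in>?K. SUP \<pi>\<in>?H. lower_gain r \<mu> \<pi> \<kappa>) = G"
    and H_upper: "(INF \<kappa>\<in>?K. SUP \<pi>\<in>?H. upper_gain r \<mu> \<pi> \<kappa>) = G"
    and S_upper: "(INF \<kappa>\<in>?K. SUP \<pi>\<in>?S. upper_gain r \<mu> \<pi> \<kappa>) = G"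
    using G_le le_G lower_weak upper_weak lower_upper_value lower_upper[of ?H] lower_upper[of ?S]
      stationary_history
    by (auto simp: G_def[symmetric] intro: order_antisym order_trans)

  have G_solution: "G = ereal \<alpha>" if sol: "inf_sup_solution r Q P u \<alpha>" for u \<alpha>
  proof (rule order_antisym)
    show "G \<le> ereal \<alpha>"
    proof (rule ereal_le_epsilon2)
      fix \<epsilon> :: real assume "0 < \<epsilon>"
      then obtain p where p: "p \<in> kernels P"
        and super: "\<And>s a. r s a + mean (p s a) u \<le> u s + (\<alpha> + \<epsilon>)"
        using inf_sup_solution_superharmonic[OF sol Q] by blast
      have "(INF \<kappa>\<in>?K. SUP \<pi>\<in>?H. upper_gain r \<mu> \<pi> \<kappa>)
          \<le> (SUP \<pi>\<in>?H. upper_gain r \<mu> \<pi> (\<lambda>h s a. p s a))"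
        by (rule INF_lower[OF stationary[OF p]])
      also have "\<dots> \<le> ereal (\<alpha> + \<epsilon>)"
        by (rule SUP_least) (rule upper_gain_le_of_superharmonic[OF super])
      finally show "G \<le> ereal \<alpha> + ereal \<epsilon>"
        by (simp add: H_upper)
    qed
    show "ereal \<alpha> \<le> G"
      unfolding G_def
    proof (rule INF_greatest)
      fix \<kappa> assume "\<kappa> \<in> ?K"
      then obtain p where p: "p \<in> kernels P" "\<kappa> = (\<lambda>h s a. p s a)"
        using adv by blast
      obtain d where "\<And>s. u s + \<alpha> \<le> r s (d s) + mean (p s (d s)) u"
        using inf_sup_solution_subharmonic[OF sol p(1)] by blast
      from lower_gain_ge_of_subharmonic[where r = r and d = d and p = p and u = u, OF this]
      show "ereal \<alpha> \<le> (SUP \<pi>\<in>?S. lower_gain r \<mu> \<pi> \<kappa>)"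
        unfolding p(2) by (rule order_trans[OF _ SUP_upper[OF deterministic_stationary[OF Q]]])
    qed
  qed
  show ?thesis
    unfolding lower_G upper_G H_lower H_upper S_upper G_def[symmetric] using G_solution by blast
qed

end
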